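(* There exists an absolute constant $C>0$ such that for every $n\geq 1$ and every isotropic log-concave probability measure $\mu$ on $\mathbb{R}^n$, $$\Gamma(\mu)\leq C n^{3/2}.$$ Equivalently, $\mu^+(\partial A)\leq Cn^{3/2}$ for every convex body $A\subset\mathbb{R}^n$.
   Context: A convex body is a compact convex set with nonempty interior. $B_2^n$ is the Euclidean unit ball. For a Borel probability measure $\mu$ on $\mathbb{R}^n$ and a convex body $A$, the $\mu$-perimeter is $\mu^+(\partial A)=\liminf_{\epsilon\to0^+}\frac{\mu((A+\epsilon B_2^n)\setminus A)}{\epsilon}$; when $\mu$ has a density $f$ this equals $\int_{\partial A} f\,d\lambda$, with $\lambda$ the $(n-1)$-dimensional Hausdorff measure. The maximal perimeter constant is $\Gamma(\mu)=\sup\{\mu^+(\partial A): A\subset\mathbb{R}^n \text{ a convex body}\}$. A probability measure $\mu$ on $\mathbb{R}^n$ is log-concave and full-dimensional if it has a density $f$ with $\ln f(\tau x+(1-\tau)y)\geq \tau\ln f(x)+(1-\tau)\ln f(y)$ for all $x,y$ and $\tau\in[0,1]$. It is isotropic if its barycenter $\int x f(x)\,dx$ is $0$ and its covariance matrix $\int x x^{T} f(x)\,dx$ is the identity. *)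

theory Defs
  imports "HOL-Probability.Probability"
begin

text \<open>R^n is represented by the carrier Rn n of extensional functions on indices {..<n};
  this carrier is the space of the product Lebesgue measure lebn n.\<close>

definition Rn :: "nat \<Rightarrow> (nat \<Rightarrow> real) set" where
  "Rn n = PiE {..<n} (\<lambda>_. UNIV)"

definition lebn :: "nat \<Rightarrow> (nat \<Rightarrow> real) measure" where
  "lebn n = PiM {..<n} (\<lambda>_. lborel)"

definition distn :: "nat \<Rightarrow> (nat \<Rightarrow> real) \<Rightarrow> (nat \<Rightarrow> real) \<Rightarrow> real" where
  "distn n x y = sqrt (\<Sum>i<n. (x i - y i)^2)"

definition combn :: "nat \<Rightarrow> real \<Rightarrow> (nat \<Rightarrow> real) \<Rightarrow> (nat \<Rightarrow> real) \<Rightarrow> (nat \<Rightarrow> real)" where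
  "combn n t x y = restrict (\<lambda>i. t * x i + (1 - t) * y i) {..<n}"

definition convex_n :: "nat \<Rightarrow> (nat \<Rightarrow> real) set \<Rightarrow> bool" where
  "convex_n n A \<longleftrightarrow> (\<forall>x\<in>A. \<forall>y\<in>A. \<forall>t\<in>{0..1}. combn n t x y \<in> A)"

text \<open>Convex body in R^n: compact convex set with nonempty (Euclidean) interior.
  On Rn n the product topology of nat => real coincides with the Euclidean one.\<close>
definition convex_body :: "nat \<Rightarrow> (nat \<Rightarrow> real) set \<Rightarrow> bool" where
  "convex_body n A \<longleftrightarrow> A \<subseteq> Rn n \<and> compact A \<and> convex_n n A \<and>
     (\<exists>x\<in>A. \<exists>r>0. {y \<in> Rn n. distn n x y < r} \<subseteq> A)"

definition enlarge :: "nat \<Rightarrow> (nat \<Rightarrow> real) set \<Rightarrow> real \<Rightarrow> (nat \<Rightarrow> real) set" where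
  "enlarge n A e = {x \<in> Rn n. \<exists>a\<in>A. distn n x a \<le> e}"

definition perimeter :: "nat \<Rightarrow> (nat \<Rightarrow> real) measure \<Rightarrow> (nat \<Rightarrow> real) set \<Rightarrow> ereal" where
  "perimeter n \<mu> A =
     Liminf (at_right 0) (\<lambda>e. ereal (measure \<mu> (enlarge n A e - A) / e))"

definition max_perimeter :: "nat \<Rightarrow> (nat \<Rightarrow> real) measure \<Rightarrow> ereal" where
  "max_perimeter n \<mu> = (SUP A\<in>{A. convex_body n A}. perimeter n \<mu> A)"

text \<open>f is the density (w.r.t. Lebesgue measure on R^n) of an isotropic log-concave
  probability measure. Log-concavity written multiplicatively (convention ln 0 = -infinity).\<close>
definition isotropic_logconcave_density :: "nat \<Rightarrow> ((nat \<Rightarrow> real) \<Rightarrow> real) \<Rightarrow> bool" where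
  "isotropic_logconcave_density n f \<longleftrightarrow>
     f \<in> borel_measurable (lebn n) \<and> (\<forall>x\<in>Rn n. f x \<ge> 0) \<and>
     integrable (lebn n) f \<and> (\<integral>x. f x \<partial>lebn n) = 1 \<and>
     (\<forall>x\<in>Rn n. \<forall>y\<in>Rn n. \<forall>t\<in>{0..1}.
        f (combn n t x y) \<ge> f x powr t * f y powr (1 - t)) \<and>
     (\<forall>i<n. integrable (lebn n) (\<lambda>x. x i * f x) \<and> (\<integral>x. x i * f x \<partial>lebn n) = 0) \<and>
     (\<forall>i<n. \<forall>j<n. integrable (lebn n) (\<lambda>x. x i * x j * f x) \<and>
        (\<integral>x. x i * x j * f x \<partial>lebn n) = (if i = j then 1 else 0))"

end

theory Submission
  imports Defs
begin

text \<open>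
If x lies within e of A but not in A, every direction theta making an angle of cosine at least
1 / (2 sqrt n) with the outer normal at x leads out of the enlarged body E within distance
d = 2 sqrt n e. Random sign vectors divided by sqrt n are such directions with probability bounded
below (fourth moments), up to sign, so it suffices that for each unit vector theta the layer
D = {x : E. x + d theta not in E} has mass O(n d).

A Jensen and entropy argument in the style of Fradelizi, for f and for f X_+, f X_- with
X = <theta, x>, produces a segment of length 2 in direction theta on which f >= exp (-16 n) sup f.
Contracting D by the factor 1 - 1 / (4 n) towards a point of this segment loses only a constant
proportion of its mass, and about 1 / (n d) of these contracted copies are disjoint.
\<close>

section \<open>Lebesgue measure on Rn\<close>

text \<open>The exponent 3/2 has two sources: \<open>sqrt n\<close> is the price of testing a normal
  with sign directions, and \<open>n\<close> is the price of a layer. In the latter, the Jacobian (1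
  - l)^n of a contraction and the loss exp (-16 n l) due to the density at its center stay bounded
  below for l of order 1 / n, but then a copy moves by about d only if its center moves by about d /
  l. The normal varies over the shell, so no single direction serves every point; a fixed proportion
  of the sign vectors serves each of them, and integrating this count over the shell reduces it to
  layers. Signs instead of uniform directions make the average a finite sum. Normals are read off
  from nearest points of A, which avoids any calculus on the boundary. As f is not known to be
  continuous or to attain its supremum, bounds are stated against every value f x, and Jensen's
  inequality rests on separating a hypograph that may fail to be closed.\<close>

interpretation lebesgue_product: product_sigma_finite "\<lambda>_::nat. lborel :: real measure"
  by standard

text \<open>One map for two uses: with a factor below 1 it is a contraction towards a point
  (\<open>combn\<close> with its second point fixed), with factor 1 a translation along a
  direction.\<close>

definition aff :: "nat \<Rightarrow> real \<Rightarrow> (nat \<Rightarrow> real) \<Rightarrow> (nat \<Rightarrow> real) \<Rightarrow> nat \<Rightarrow> real" where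
  "aff n c b x = restrict (\<lambda>i. c * x i + b i) {..<n}"

lemma space_lebn [simp]: "space (lebn n) = Rn n"
  by (simp add: lebn_def Rn_def space_PiM)

lemma measurable_coordinate_lebn [measurable]:
  "i < n \<Longrightarrow> (\<lambda>x. x i) \<in> borel_measurable (lebn n)"
  unfolding lebn_def by measurable

lemma aff_in_Rn [simp]: "aff n c b x \<in> Rn n"
  by (auto simp: aff_def Rn_def)

lemma measurable_aff [measurable]: "aff n c b \<in> measurable (lebn n) (lebn n)"
  unfolding aff_def lebn_def by measurable

lemma combn_eq_aff: "combn n t x y = aff n t (\<lambda>i. (1 - t) * y i) x"
  by (simp add: combn_def aff_def)

lemma combn_in_Rn [simp]: "combn n t x y \<in> Rn n"
  by (simp add: combn_eq_aff)

lemma measurable_combn [measurable]: "(\<lambda>x. combn n t x y) \<in> measurable (lebn n) (lebn n)"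
  by (simp add: combn_eq_aff)

text \<open>A product measure is determined by its values on boxes, and the preimage of a box is a
  box; the one-dimensional scaling law contributes one factor \<open>c\<close> per
  coordinate.\<close>

lemma lebn_eq_density_distr_aff:
  assumes c: "c > 0"
  shows "lebn n = density (distr (lebn n) (lebn n) (aff n c b)) (\<lambda>_. ennreal (c ^ n))"
proof -
  let ?P = "density (distr (lebn n) (lebn n) (aff n c b)) (\<lambda>_. ennreal (c ^ n))"
  have "?P = PiM {..<n} (\<lambda>_. lborel)"
  proof (rule lebesgue_product.PiM_eqI)
    fix A :: "nat \<Rightarrow> real set"
    assume A: "\<And>i. i \<in> {..<n} \<Longrightarrow> A i \<in> sets lborel"
    let ?B = "\<lambda>i. (\<lambda>x. b i + c * x) -` A i"
    have B: "?B i \<in> sets lborel" if "i < n" for i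
    proof -
      have "(\<lambda>x. b i + c * x) \<in> borel_measurable borel" by simp
      then show ?thesis using A[of i] that measurable_sets[of "\<lambda>x. b i + c * x" borel borel "A i"]
        by auto
    qed
    have eA: "emeasure lborel (A i) = ennreal c * emeasure lborel (?B i)" if "i < n" for i
    proof -
      have m: "A i \<in> sets borel" using A[of i] that by simp
      have "emeasure lborel (A i)
          = emeasure (density (distr lborel borel (\<lambda>x. b i + c * x)) (\<lambda>_. ennreal \<bar>c\<bar>)) (A i)"
        using lborel_real_affine[of c "b i"] c by simp
      also have "\<dots> = ennreal c * emeasure (distr lborel borel (\<lambda>x. b i + c * x)) (A i)"
        using c m by (subst emeasure_density_const) auto
      also have "\<dots> = ennreal c * emeasure lborel (?B i)"
        using m by (subst emeasure_distr) auto
      finally show ?thesis .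
    qed
    have sA: "Pi\<^sub>E {..<n} A \<in> sets (lebn n)"
      unfolding lebn_def using A by (intro sets_PiM_I_finite) auto
    have pre: "aff n c b -` Pi\<^sub>E {..<n} A \<inter> Rn n = Pi\<^sub>E {..<n} ?B"
      by (auto simp: aff_def Rn_def PiE_iff restrict_def extensional_def add.commute)
    have "emeasure ?P (Pi\<^sub>E {..<n} A) = ennreal (c ^ n) * emeasure (lebn n) (Pi\<^sub>E {..<n} ?B)"
      using sA by (simp add: emeasure_density_const emeasure_distr pre)
    also have "emeasure (lebn n) (Pi\<^sub>E {..<n} ?B) = (\<Prod>i<n. emeasure lborel (?B i))"
      unfolding lebn_def using B by (intro lebesgue_product.emeasure_PiM) auto
    also have "ennreal (c ^ n) * (\<Prod>i<n. emeasure lborel (?B i)) = (\<Prod>i<n. emeasure lborel (A i))"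
      using c by (simp add: eA prod.distrib ennreal_power)
    finally show "emeasure ?P (Pi\<^sub>E {..<n} A) = (\<Prod>i<n. emeasure lborel (A i))" .
  qed (auto simp: lebn_def)
  then show ?thesis by (simp add: lebn_def)
qed

lemma nn_integral_aff:
  assumes c: "c > 0" and [measurable]: "g \<in> borel_measurable (lebn n)"
  shows "(\<integral>\<^sup>+x. g x \<partial>lebn n) = ennreal (c ^ n) * (\<integral>\<^sup>+x. g (aff n c b x) \<partial>lebn n)"
  by (subst lebn_eq_density_distr_aff[OF c, of n b])
     (simp add: nn_integral_density nn_integral_distr nn_integral_cmult)

lemma integrable_aff:
  fixes g :: "(nat \<Rightarrow> real) \<Rightarrow> real"
  assumes c: "c > 0" and [measurable]: "g \<in> borel_measurable (lebn n)"
  shows "integrable (lebn n) (\<lambda>x. g (aff n c b x)) \<longleftrightarrow> integrable (lebn n) g"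
proof -
  have "integrable (lebn n) g \<longleftrightarrow> integrable (density (distr (lebn n) (lebn n) (aff n c b)) (\<lambda>_. ennreal (c ^ n))) g"
    using lebn_eq_density_distr_aff[OF c, of n b] by simp
  also have "\<dots> \<longleftrightarrow> integrable (lebn n) (\<lambda>x. g (aff n c b x))"
    using c by (subst integrable_density) (auto simp: integrable_distr_eq)
  finally show ?thesis by simp
qed

lemma integral_aff:
  fixes g :: "(nat \<Rightarrow> real) \<Rightarrow> real"
  assumes c: "c > 0" and [measurable]: "g \<in> borel_measurable (lebn n)"
  shows "(\<integral>x. g x \<partial>lebn n) = c ^ n * (\<integral>x. g (aff n c b x) \<partial>lebn n)"
proof -
  have "(\<integral>x. g x \<partial>lebn n) = (\<integral>x. g x \<partial>density (distr (lebn n) (lebn n) (aff n c b)) (\<lambda>_. ennreal (c ^ n)))"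
    using lebn_eq_density_distr_aff[OF c, of n b] by simp
  also have "\<dots> = c ^ n * (\<integral>x. g (aff n c b x) \<partial>lebn n)"
    using c by (subst integral_density) (auto simp: integral_distr)
  finally show ?thesis .
qed

text \<open>Fubini in coordinate \<open>j\<close>: since \<open>a j\<close> is nonzero, a line in
  that direction meets the hyperplane in at most one point. This disposes of vertical separating
  hyperplanes in Jensen's inequality.\<close>

lemma null_set_hyperplane:
  fixes a :: "nat \<Rightarrow> real"
  assumes j: "j < n" "a j \<noteq> 0"
  shows "{x \<in> Rn n. (\<Sum>i<n. a i * x i) = c} \<in> null_sets (lebn n)"
proof -
  let ?H = "{x \<in> Rn n. (\<Sum>i<n. a i * x i) = c}"
  let ?J = "{..<n} - {j}"
  have ins: "{..<n} = insert j ?J" using j by auto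
  have "{x \<in> space (lebn n). (\<Sum>i<n. a i * x i) = c} \<in> sets (lebn n)" by measurable
  then have H: "?H \<in> sets (lebn n)" by simp
  have "emeasure (lebn n) ?H = (\<integral>\<^sup>+x. indicator ?H x \<partial>PiM (insert j ?J) (\<lambda>_. lborel))"
    unfolding ins[symmetric] lebn_def[symmetric] using H by simp
  also have "\<dots> = (\<integral>\<^sup>+x. (\<integral>\<^sup>+y. indicator ?H (x(j := y)) \<partial>lborel) \<partial>PiM ?J (\<lambda>_. lborel))"
  proof (rule lebesgue_product.product_nn_integral_insert)
    show "indicator ?H \<in> borel_measurable (PiM (insert j ?J) (\<lambda>_. lborel))"
      unfolding ins[symmetric] lebn_def[symmetric] using H by (rule borel_measurable_indicator)
  qed auto
  also have "\<dots> = (\<integral>\<^sup>+x. 0 \<partial>PiM ?J (\<lambda>_. lborel :: real measure))"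
  proof (intro nn_integral_cong)
    fix x :: "nat \<Rightarrow> real"
    let ?y = "(c - (\<Sum>i\<in>?J. a i * x i)) / a j"
    have "(\<integral>\<^sup>+y. indicator ?H (x(j := y)) \<partial>lborel) \<le> (\<integral>\<^sup>+y. indicator {?y} y \<partial>lborel)"
    proof (intro nn_integral_mono)
      fix y :: real
      have "y = ?y" if "x(j := y) \<in> ?H"
      proof -
        have "(\<Sum>i<n. a i * (x(j := y)) i) = a j * y + (\<Sum>i\<in>?J. a i * (x(j := y)) i)"
          by (subst sum.remove[of _ j]) (use j in auto)
        also have "(\<Sum>i\<in>?J. a i * (x(j := y)) i) = (\<Sum>i\<in>?J. a i * x i)"
          by (intro sum.cong) auto
        finally show ?thesis using that j by (simp add: field_simps)
      qed
      then show "indicator ?H (x(j := y)) \<le> (indicator {?y} y :: ennreal)"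
        by (auto simp: indicator_def)
    qed
    also have "\<dots> = 0" by simp
    finally show "(\<integral>\<^sup>+y. indicator ?H (x(j := y)) \<partial>lborel) = 0" by simp
  qed
  finally show ?thesis using H by auto
qed

section \<open>Jensen's inequality in Rn\<close>

definition segment_point :: "real \<Rightarrow> (nat \<Rightarrow> real) \<Rightarrow> (nat \<Rightarrow> real) \<Rightarrow> nat \<Rightarrow> real" where
  [simp]: "segment_point t x y i = t * x i + (1 - t) * y i"

lemma segment_point_0 [simp]: "segment_point 0 x y = y"
  and segment_point_1 [simp]: "segment_point 1 x y = x"
  by auto

text \<open>Unlike \<open>combn\<close>, \<open>segment_point\<close> applies no
  \<open>restrict\<close>: the sets live in the full type \<open>nat => real\<close>, where
  coordinate \<open>n\<close> is free to hold the value of a function on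
  \<open>Rn n\<close>.\<close>

definition segment_convex :: "(nat \<Rightarrow> real) set \<Rightarrow> bool" where
  "segment_convex S \<longleftrightarrow> (\<forall>x\<in>S. \<forall>y\<in>S. \<forall>t\<in>{0..1}. segment_point t x y \<in> S)"

lemma segment_convexD:
  "segment_convex S \<Longrightarrow> x \<in> S \<Longrightarrow> y \<in> S \<Longrightarrow> 0 \<le> t \<Longrightarrow> t \<le> 1 \<Longrightarrow> segment_point t x y \<in> S"
  by (simp add: segment_convex_def)

text \<open>Division by \<open>t\<close> and the limit at 0, made explicit by one \<open>t\<close>
  so small that \<open>t * D\<close> is at most \<open>- B\<close>.\<close>

lemma nonneg_linear_coefficient:
  fixes B D :: real
  assumes "\<And>t. 0 < t \<Longrightarrow> t \<le> 1 \<Longrightarrow> 0 \<le> 2 * t * B + t\<^sup>2 * D" "D \<ge> 0"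
  shows "B \<ge> 0"
proof (rule ccontr)
  assume "\<not> B \<ge> 0"
  then have B: "B < 0" by simp
  define t where "t = min 1 (- B / (D + 1))"
  have "0 < - B / (D + 1)" using B assms(2) by (intro divide_pos_pos) auto
  then have t: "0 < t" "t \<le> 1" "t \<le> - B / (D + 1)" by (auto simp: t_def)
  have "t * D \<le> - B / (D + 1) * D" using t assms(2) by (intro mult_right_mono) auto
  also have "\<dots> \<le> - B" using B assms(2) by (simp add: field_simps)
  finally have "2 * B + t * D < 0" using B by simp
  then have "t * (2 * B + t * D) < 0" using t by (simp add: mult_pos_neg)
  then show False using assms(1)[OF t(1,2)] by (simp add: power2_eq_square algebra_simps)
qed

text \<open>First variation at \<open>c\<close> of the squared distance to \<open>q\<close>. The
  assumption concerns a single segment, so the lemma serves both \<open>segment_convex\<close> and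
  \<open>convex_n\<close> sets.\<close>

lemma minimizer_variational_inequality:
  fixes c q y :: "nat \<Rightarrow> real"
  assumes "\<And>t. 0 < t \<Longrightarrow> t \<le> 1 \<Longrightarrow>
    (\<Sum>i<m. (c i - q i)\<^sup>2) \<le> (\<Sum>i<m. (t * y i + (1 - t) * c i - q i)\<^sup>2)"
  shows "0 \<le> (\<Sum>i<m. (c i - q i) * (y i - c i))"
proof (rule nonneg_linear_coefficient)
  show "0 \<le> (\<Sum>i<m. (y i - c i)\<^sup>2)" by (simp add: sum_nonneg)
  fix t :: real assume t: "0 < t" "t \<le> 1"
  have "(\<Sum>i<m. (t * y i + (1 - t) * c i - q i)\<^sup>2)
      = (\<Sum>i<m. (c i - q i)\<^sup>2 + 2 * t * ((c i - q i) * (y i - c i)) + t\<^sup>2 * (y i - c i)\<^sup>2)"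
    by (intro sum.cong) (auto simp: power2_eq_square algebra_simps)
  also have "\<dots> = (\<Sum>i<m. (c i - q i)\<^sup>2) + 2 * t * (\<Sum>i<m. (c i - q i) * (y i - c i))
      + t\<^sup>2 * (\<Sum>i<m. (y i - c i)\<^sup>2)"
    by (simp add: sum.distrib sum_distrib_left)
  finally show "0 \<le> 2 * t * (\<Sum>i<m. (c i - q i) * (y i - c i)) + t\<^sup>2 * (\<Sum>i<m. (y i - c i)\<^sup>2)"
    using assms[OF t] by simp
qed

lemma compact_PiE_UNIV:
  fixes K :: "'i \<Rightarrow> 'a::topological_space set"
  assumes "\<And>i. compact (K i)"
  shows "compact (PiE UNIV K)"
proof -
  have "compactin (product_topology (\<lambda>i. euclidean) UNIV) (PiE UNIV K)"
    using assms by (simp add: compactin_PiE)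
  then show ?thesis by (simp add: euclidean_product_topology)
qed

lemma continuous_on_coordinate [continuous_intros]:
  "continuous_on A (\<lambda>x :: nat \<Rightarrow> real. x i)"
  by (rule continuous_on_subset[OF continuous_on_product_coordinates]) simp

text \<open>Induction on \<open>F\<close>: the join of a new point \<open>y\<close> with a compact
  convex \<open>C\<close> is a continuous image of \<open>{0..1}\<close> times \<open>C\<close>,
  hence compact, and regrouping weights shows that it is convex.\<close>

lemma compact_segment_convex_hull:
  assumes "finite F" "F \<noteq> {}" "F \<subseteq> S" "segment_convex S"
  shows "\<exists>C. F \<subseteq> C \<and> C \<subseteq> S \<and> compact C \<and> segment_convex C"
  using assms(1-3)
proof (induction F rule: finite_ne_induct)
  case (singleton x)
  have "segment_point t x x = x" for t by (auto simp: fun_eq_iff algebra_simps)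
  then show ?case using singleton by (intro exI[of _ "{x}"]) (simp add: segment_convex_def)
next
  case (insert y F)
  then obtain C where C: "F \<subseteq> C" "C \<subseteq> S" "compact C" "segment_convex C" by auto
  define C' where "C' = (\<lambda>p. segment_point (fst p) y (snd p)) ` ({0..1} \<times> C)"
  have C'E: "\<exists>t\<in>{0..1}. \<exists>c\<in>C. x = segment_point t y c" if x: "x \<in> C'" for x
  proof -
    from x obtain p where "x = segment_point (fst p) y (snd p)" "p \<in> {0..1} \<times> C"
      unfolding C'_def by (rule imageE)
    then show ?thesis by (intro bexI[of _ "fst p"] bexI[of _ "snd p"]) (auto simp: mem_Times_iff)
  qed
  obtain c0 where c0: "c0 \<in> C" using insert C by blast
  have mem: "segment_point t y c \<in> C'" if "0 \<le> t" "t \<le> 1" "c \<in> C" for t c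
    unfolding C'_def using that by (intro image_eqI[of _ _ "(t, c)"]) auto
  have "y \<in> C'" using mem[of 1 c0] c0 by simp
  moreover have "C \<subseteq> C'" using mem[of 0] by auto
  moreover have "C' \<subseteq> S"
  proof
    fix x assume "x \<in> C'"
    then obtain t c where "t \<in> {0..1}" "c \<in> C" "x = segment_point t y c"
      using C'E by meson
    moreover from this have "y \<in> S" "c \<in> S" using C(2) insert.prems by auto
    ultimately show "x \<in> S" using segment_convexD[OF assms(4), of y c t] by simp
  qed
  moreover have "compact C'"
    unfolding C'_def
  proof (intro compact_continuous_image compact_Times C continuous_on_coordinatewise_then_product)
    fix i
    have "continuous_on ({0..1} \<times> C) (\<lambda>p :: real \<times> (nat \<Rightarrow> real). snd p i)"
      by (rule continuous_on_product_then_coordinatewise) (intro continuous_intros)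
    then show "continuous_on ({0..1} \<times> C) (\<lambda>p. segment_point (fst p) y (snd p) i)"
      by (simp, intro continuous_intros)
  qed auto
  moreover have "segment_convex C'"
    unfolding segment_convex_def
  proof (intro ballI)
    fix x x' s assume mem_x: "x \<in> C'" "x' \<in> C'" and s: "s \<in> {0..1::real}"
    obtain t1 c1 where 1: "t1 \<in> {0..1}" "c1 \<in> C" "x = segment_point t1 y c1"
      using C'E[OF mem_x(1)] by meson
    obtain t2 c2 where 2: "t2 \<in> {0..1}" "c2 \<in> C" "x' = segment_point t2 y c2"
      using C'E[OF mem_x(2)] by meson
    note t = 1(1) 2(1) and c = 1(2) 2(2) and x = 1(3) 2(3)
    \<comment> \<open>The total weight that the combination places on \<open>y\<close>; the
      remaining weight, if positive, is renormalised to a point of \<open>C\<close>.\<close>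
    define t where "t = s * t1 + (1 - s) * t2"
    have t01: "0 \<le> t" "t \<le> 1"
      using s t convex_bound_le[of t1 1 t2 s "1 - s"] by (auto simp: t_def)
    have nn: "0 \<le> s * (1 - t1)" "0 \<le> (1 - s) * (1 - t2)"
      using s t by auto
    have sum: "s * (1 - t1) + (1 - s) * (1 - t2) = 1 - t"
      by (simp add: t_def algebra_simps)
    show "segment_point s x x' \<in> C'"
    proof (cases "t = 1")
      case True
      then have "s * (1 - t1) = 0" "(1 - s) * (1 - t2) = 0"
        using nn sum by linarith+
      have "segment_point s x x' = segment_point 1 y c1"
      proof
        fix i
        have "segment_point s x x' i = t * y i + s * (1 - t1) * c1 i + (1 - s) * (1 - t2) * c2 i"
          by (simp add: x t_def algebra_simps)
        also have "\<dots> = y i"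
          by (simp only: True \<open>s * (1 - t1) = 0\<close> \<open>(1 - s) * (1 - t2) = 0\<close> mult_zero_left mult_1 add_0_right)
        finally show "segment_point s x x' i = segment_point 1 y c1 i" by simp
      qed
      then show ?thesis using mem[of 1 c1] c by simp
    next
      case False
      define r where "r = s * (1 - t1) / (1 - t)"
      have r1: "(1 - t) * r = s * (1 - t1)"
        using False by (simp add: r_def)
      have "(1 - t) * (1 - r) = (1 - t) - (1 - t) * r" by (simp add: right_diff_distrib)
      also have "\<dots> = (1 - s) * (1 - t2)" using r1 sum by linarith
      finally have r2: "(1 - t) * (1 - r) = (1 - s) * (1 - t2)" .
      have "0 \<le> r" "r \<le> 1"
        using False nn sum t01 by (auto simp: r_def divide_le_eq)
      then have "segment_point r c1 c2 \<in> C" using segment_convexD[OF C(4)] c by simp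
      moreover have "segment_point s x x' = segment_point t y (segment_point r c1 c2)"
      proof
        fix i
        have "(1 - t) * (r * c1 i + (1 - r) * c2 i) = ((1 - t) * r) * c1 i + ((1 - t) * (1 - r)) * c2 i"
          by (simp add: algebra_simps)
        also have "\<dots> = s * (1 - t1) * c1 i + (1 - s) * (1 - t2) * c2 i" by (simp only: r1 r2)
        finally show "segment_point s x x' i = segment_point t y (segment_point r c1 c2) i"
          by (simp add: x t_def algebra_simps)
      qed
      ultimately show ?thesis using mem[of t "segment_point r c1 c2"] t01 by simp
    qed
  qed
  ultimately show ?case using C(1) by (intro exI[of _ C']) auto
qed

text \<open>The nearest point \<open>c\<close> to \<open>q\<close>, with distances taken in the
  first \<open>m\<close> coordinates, gives the normal \<open>c - q\<close>. Its unit length and its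
  zeros from \<open>m\<close> on confine it to one compact set that does not depend on
  \<open>C\<close>.\<close>

lemma separating_functional_compact:
  assumes C: "compact C" "C \<noteq> {}" "segment_convex C" and q: "\<And>y. y \<in> C \<Longrightarrow> \<exists>i<m. y i \<noteq> q i"
  shows "\<exists>a. (\<Sum>i<m. (a i)\<^sup>2) = 1 \<and> (\<forall>i\<ge>m. a i = 0) \<and> (\<forall>y\<in>C. 0 \<le> (\<Sum>i<m. a i * (y i - q i)))"
proof -
  have "continuous_on C (\<lambda>y. \<Sum>i<m. (y i - q i)\<^sup>2)"
    by (intro continuous_intros)
  then obtain c where c: "c \<in> C" and min: "\<And>y. y \<in> C \<Longrightarrow> (\<Sum>i<m. (c i - q i)\<^sup>2) \<le> (\<Sum>i<m. (y i - q i)\<^sup>2)"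
    using continuous_attains_inf[OF C(1,2)] by blast
  define g where "g = (\<Sum>i<m. (c i - q i)\<^sup>2)"
  obtain j where "j < m" "c j \<noteq> q j" using q[OF c] by auto
  then have "g > 0" unfolding g_def by (intro sum_pos2[of _ j]) auto
  define a where "a = (\<lambda>i. if i < m then (c i - q i) / sqrt g else 0)"
  have "(\<Sum>i<m. (a i)\<^sup>2) = (\<Sum>i<m. (c i - q i)\<^sup>2 / g)"
    using \<open>g > 0\<close> by (intro sum.cong) (auto simp: a_def power_divide)
  then have "(\<Sum>i<m. (a i)\<^sup>2) = 1"
    using \<open>g > 0\<close> by (simp add: g_def flip: sum_divide_distrib)
  moreover have "0 \<le> (\<Sum>i<m. a i * (y i - q i))" if y: "y \<in> C" for y
  proof -
    have "0 \<le> (\<Sum>i<m. (c i - q i) * (y i - c i))"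
    proof (rule minimizer_variational_inequality)
      fix t :: real assume "0 < t" "t \<le> 1"
      then have "segment_point t y c \<in> C" using segment_convexD[OF C(3)] y c by simp
      from min[OF this] show "(\<Sum>i<m. (c i - q i)\<^sup>2) \<le> (\<Sum>i<m. (t * y i + (1 - t) * c i - q i)\<^sup>2)" by simp
    qed
    also have "\<dots> \<le> \<dots> + g" using \<open>g > 0\<close> by simp
    also have "\<dots> = (\<Sum>i<m. (c i - q i) * (y i - q i))"
      unfolding g_def sum.distrib[symmetric] by (intro sum.cong) (auto simp: power2_eq_square algebra_simps)
    finally have "0 \<le> (\<Sum>i<m. (c i - q i) * (y i - q i)) / sqrt g" using \<open>g > 0\<close> by simp
    also have "\<dots> = (\<Sum>i<m. a i * (y i - q i))"
      unfolding sum_divide_distrib by (intro sum.cong) (auto simp: a_def)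
    finally show ?thesis .
  qed
  ultimately show ?thesis by (intro exI[of _ a]) (auto simp: a_def)
qed

text \<open>No closedness of S is assumed: separate the hulls of finite subsets, and use that the unit
  sphere is compact.\<close>
lemma separating_functional:
  assumes S: "S \<noteq> {}" "segment_convex S" and q: "\<And>y. y \<in> S \<Longrightarrow> \<exists>i<m. y i \<noteq> q i"
  shows "\<exists>a. (\<exists>i<m. a i \<noteq> 0) \<and> (\<forall>y\<in>S. 0 \<le> (\<Sum>i<m. a i * (y i - q i)))"
proof -
  obtain y0 where y0: "y0 \<in> S" using S by auto
  \<comment> \<open>Zero coordinates from \<open>m\<close> on make every factor, hence the product,
    compact; \<open>K\<close> is the unit sphere inside it.\<close>
  define B where "B = PiE UNIV (\<lambda>i. if i < m then {-1..1} else {0::real})"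
  define K where "K = B \<inter> {a. (\<Sum>i<m. (a i)\<^sup>2) = 1}"
  define H where "H = (\<lambda>y. {a::nat \<Rightarrow> real. 0 \<le> (\<Sum>i<m. a i * (y i - q i))})"
  have "closed {a::nat \<Rightarrow> real. (\<Sum>i<m. (a i)\<^sup>2) = 1}"
    by (intro closed_Collect_eq continuous_intros)
  moreover have "compact B" unfolding B_def by (intro compact_PiE_UNIV) auto
  ultimately have K: "compact K" unfolding K_def by (rule compact_Int_closed[rotated])
  have H: "closed (H y)" for y
    unfolding H_def by (intro closed_Collect_le continuous_intros)
  have fip: "K \<inter> (\<Inter>y\<in>F. H y) \<noteq> {}" if F: "finite F" "F \<subseteq> S" for F
  proof -
    \<comment> \<open>\<open>y0\<close> keeps the hull nonempty when \<open>F\<close> is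
      empty.\<close>
    obtain C where C: "insert y0 F \<subseteq> C" "C \<subseteq> S" "compact C" "segment_convex C"
      using compact_segment_convex_hull[of "insert y0 F" S] F y0 S by auto
    obtain a where a: "(\<Sum>i<m. (a i)\<^sup>2) = 1" "\<forall>i\<ge>m. a i = 0" "\<forall>y\<in>C. 0 \<le> (\<Sum>i<m. a i * (y i - q i))"
      using separating_functional_compact[of C m q] C q by blast
    have "\<bar>a i\<bar> \<le> 1" if "i < m" for i
    proof -
      have "(a i)\<^sup>2 \<le> (\<Sum>i<m. (a i)\<^sup>2)" using that by (intro member_le_sum) auto
      then show ?thesis using a(1) abs_le_square_iff[of "a i" 1] by simp
    qed
    then have "a \<in> B" using a(2) by (auto simp: B_def abs_le_iff minus_le_iff)
    then have "a \<in> K \<inter> (\<Inter>y\<in>F. H y)" using a C(1) by (auto simp: K_def H_def)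
    then show ?thesis by blast
  qed
  have "K \<inter> (\<Inter>y\<in>S. H y) \<noteq> {}" by (rule compact_imp_fip_image[OF K H fip])
  then obtain a where a: "a \<in> K" "\<And>y. y \<in> S \<Longrightarrow> a \<in> H y" by auto
  moreover have "\<exists>i<m. a i \<noteq> 0"
  proof (rule ccontr)
    assume "\<not> ?thesis"
    then have "(\<Sum>i<m. (a i)\<^sup>2) = 0" by simp
    then show False using a(1) by (simp add: K_def)
  qed
  ultimately show ?thesis by (auto simp: H_def)
qed

text \<open>The hypograph of u lies in n + 1 coordinates, the last one holding the value.\<close>
lemma jensen_concave_lebn:
  fixes p u :: "(nat \<Rightarrow> real) \<Rightarrow> real"
  assumes p: "\<And>x. x \<in> Rn n \<Longrightarrow> p x \<ge> 0" "integrable (lebn n) p" "(\<integral>x. p x \<partial>lebn n) = 1"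
    and z: "z \<in> Rn n" "\<And>i. i < n \<Longrightarrow> integrable (lebn n) (\<lambda>x. x i * p x)"
      "\<And>i. i < n \<Longrightarrow> (\<integral>x. x i * p x \<partial>lebn n) = z i"
    and P: "\<And>x y t. x \<in> P \<Longrightarrow> y \<in> P \<Longrightarrow> t \<in> {0..1} \<Longrightarrow>
        combn n t x y \<in> P \<and> u (combn n t x y) \<ge> t * u x + (1 - t) * u y"
      "P \<subseteq> Rn n" "\<And>x. x \<in> Rn n \<Longrightarrow> p x \<noteq> 0 \<Longrightarrow> x \<in> P"
    and u: "integrable (lebn n) (\<lambda>x. p x * u x)"
  shows "z \<in> P \<and> (\<integral>x. p x * u x \<partial>lebn n) \<le> u z"
proof -
  let ?I = "\<integral>x. p x * u x \<partial>lebn n"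
  \<comment> \<open>The strict gap below the mean is what later forces \<open>a n = 0\<close>; the
    mean itself is reached at the end through \<open>dense_le\<close>.\<close>
  have below: "z \<in> P \<and> s \<le> u z" if s: "s < ?I" for s
  proof (rule ccontr)
    assume neg: "\<not> (z \<in> P \<and> s \<le> u z)"
    let ?r = "\<lambda>y::nat\<Rightarrow>real. restrict y {..<n}"
    define S where "S = {y. ?r y \<in> P \<and> y n \<le> u (?r y)}"
    define q where "q = z(n := s)"
    have rP: "?r x = x" if "x \<in> Rn n" for x
      using that by (simp add: Rn_def PiE_restrict)
    have memS: "x(n := t) \<in> S" if "x \<in> P" "t \<le> u x" for x t
      using that P(2) rP[of x] by (auto simp: S_def)
    have "P \<noteq> {}"
    proof
      assume "P = {}"
      then have "(\<integral>x. p x \<partial>lebn n) = (\<integral>x. 0 \<partial>lebn n)"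
        using P(3) by (intro Bochner_Integration.integral_cong) auto
      then show False using p(3) by simp
    qed
    then obtain x0 where x0: "x0 \<in> P" by auto
    have "segment_convex S"
      unfolding segment_convex_def
    proof (intro ballI)
      fix x y t assume xy: "x \<in> S" "y \<in> S" and t: "t \<in> {0..1::real}"
      have eq: "?r (segment_point t x y) = combn n t (?r x) (?r y)"
        by (auto simp: combn_def restrict_def)
      have "t * x n + (1 - t) * y n \<le> t * u (?r x) + (1 - t) * u (?r y)"
        using xy t by (intro add_mono mult_left_mono) (auto simp: S_def)
      also have "\<dots> \<le> u (combn n t (?r x) (?r y))"
        using xy t P(1) by (auto simp: S_def)
      finally show "segment_point t x y \<in> S"
        using xy t P(1) by (auto simp: S_def eq)
    qed
    moreover have "S \<noteq> {}" using memS[OF x0 order_refl] by blast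
    moreover have "\<exists>i<Suc n. y i \<noteq> q i" if "y \<in> S" for y
    proof (rule ccontr)
      assume "\<not> ?thesis"
      then have "\<forall>i<Suc n. y i = q i" by auto
      then have "?r y = ?r z" "y n = s"
        by (auto simp: q_def intro!: restrict_ext)
      then have "?r y = z" "y n = s"
        using rP[OF z(1)] by simp_all
      then show False using that neg by (simp add: S_def)
    qed
    ultimately obtain a where a0: "\<exists>i<Suc n. a i \<noteq> 0"
      and a: "\<forall>y\<in>S. 0 \<le> (\<Sum>i<Suc n. a i * (y i - q i))"
      using separating_functional[of S "Suc n" q] by blast
    have a': "0 \<le> (\<Sum>i<n. a i * (x i - z i)) + a n * (t - s)" if "x \<in> P" "t \<le> u x" for x t
      using a memS[OF that] by (auto simp: q_def)
    \<comment> \<open>The hypograph extends downwards without bound, so a positive last coefficient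
      would violate the separation at a low enough \<open>t\<close>.\<close>
    have an: "a n \<le> 0"
    proof (rule ccontr)
      assume pos: "\<not> a n \<le> 0"
      define A where "A = (\<Sum>i<n. a i * (x0 i - z i))"
      define t where "t = min (u x0) (s - (\<bar>A\<bar> + 1) / a n)"
      have "a n * (t - s) \<le> a n * (- (\<bar>A\<bar> + 1) / a n)"
      proof (intro mult_left_mono)
        have "t \<le> s - (\<bar>A\<bar> + 1) / a n" by (simp add: t_def)
        then show "t - s \<le> - (\<bar>A\<bar> + 1) / a n" by (simp only: minus_divide_left)
      qed (use pos in simp)
      also have "\<dots> = - (\<bar>A\<bar> + 1)" using pos by simp
      finally have "A + a n * (t - s) < 0" by simp
      then show False using a'[OF x0, of t] by (simp add: A_def t_def)
    qed
    \<comment> \<open>The separation inequality at \<open>(x, u x)\<close>, weighted by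
      \<open>p\<close>. It is nonnegative, while the barycenter condition cancels the linear part of
      its integral and leaves \<open>a n * (?I - s)\<close>, at most 0; so \<open>h\<close> vanishes
      almost everywhere.\<close>
    define h where "h = (\<lambda>x. p x * ((\<Sum>i<n. a i * (x i - z i)) + a n * (u x - s)))"
    have h_eq: "h x = (\<Sum>i<n. a i * (x i * p x) - a i * z i * p x) + (a n * (p x * u x) - a n * s * p x)" for x
      by (simp add: h_def algebra_simps sum_distrib_left sum_distrib_right sum.distrib sum_subtractf)
    have int_lin: "integrable (lebn n) (\<lambda>x. a i * (x i * p x) - a i * z i * p x)"
        "(\<integral>x. a i * (x i * p x) - a i * z i * p x \<partial>lebn n) = 0" if "i < n" for i
      using p(2,3) z(2,3)[OF that] by simp_all
    have int_val: "integrable (lebn n) (\<lambda>x. a n * (p x * u x) - a n * s * p x)"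
        "(\<integral>x. a n * (p x * u x) - a n * s * p x \<partial>lebn n) = a n * (?I - s)"
      using p(2,3) u by (simp_all add: algebra_simps)
    have int_sum: "integrable (lebn n) (\<lambda>x. \<Sum>i<n. a i * (x i * p x) - a i * z i * p x)"
      using int_lin(1) by (intro Bochner_Integration.integrable_sum) auto
    have h_int: "integrable (lebn n) h"
      unfolding h_eq[abs_def] by (rule Bochner_Integration.integrable_add[OF int_sum int_val(1)])
    have "(\<integral>x. h x \<partial>lebn n) = (\<integral>x. (\<Sum>i<n. a i * (x i * p x) - a i * z i * p x) \<partial>lebn n) + a n * (?I - s)"
      unfolding h_eq[abs_def] using Bochner_Integration.integral_add[OF int_sum int_val(1)] int_val(2) by simp
    also have "(\<integral>x. (\<Sum>i<n. a i * (x i * p x) - a i * z i * p x) \<partial>lebn n) = 0"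
      using int_lin by (subst Bochner_Integration.integral_sum) auto
    finally have h_val: "(\<integral>x. h x \<partial>lebn n) = a n * (?I - s)" by simp
    have "a n * (?I - s) \<le> 0" using an s by (intro mult_nonpos_nonneg) auto
    then have le0: "(\<integral>x. h x \<partial>lebn n) \<le> 0" using h_val by simp
    have h0: "0 \<le> h x" if "x \<in> Rn n" for x
    proof (cases "p x = 0")
      case False
      then show ?thesis using P(3)[OF that] p(1)[OF that] a'[of x "u x"] by (simp add: h_def)
    qed (simp add: h_def)
    have h00: "(\<integral>x. h x \<partial>lebn n) = 0"
      using le0 h0 by (intro antisym integral_nonneg_AE) auto
    then have "a n * (?I - s) = 0" using h_val by simp
    then have an0: "a n = 0" using s by simp
    then obtain j where j: "j < n" "a j \<noteq> 0" using a0 less_Suc_eq by auto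
    \<comment> \<open>With \<open>a n = 0\<close> the hyperplane is vertical: \<open>p\<close> would
      be carried by a null set, against its total mass 1.\<close>
    have "AE x in lebn n. h x = 0"
      using h00 h0 h_int by (subst integral_nonneg_eq_0_iff_AE[symmetric]) auto
    moreover have "AE x in lebn n. x \<notin> {x \<in> Rn n. (\<Sum>i<n. a i * x i) = (\<Sum>i<n. a i * z i)}"
      by (rule AE_not_in[OF null_set_hyperplane[where a = a, OF j]])
    ultimately have "AE x in lebn n. p x = 0"
      using AE_space
    proof eventually_elim
      case (elim x)
      then show ?case by (simp add: h_def an0 right_diff_distrib sum_subtractf)
    qed
    then have "(\<integral>x. p x \<partial>lebn n) = 0" by (rule integral_eq_zero_AE)
    then show False using p(3) by simp
  qed
  have "z \<in> P" using below[of "?I - 1"] by simp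
  moreover have "?I \<le> u z"
  proof (rule dense_le)
    fix s assume "s < ?I"
    from below[OF this] show "s \<le> u z" ..
  qed
  ultimately show ?thesis by simp
qed

section \<open>Points of high density\<close>

abbreviation originn :: "nat \<Rightarrow> nat \<Rightarrow> real" where
  "originn n \<equiv> restrict (\<lambda>_. 0) {..<n}"

lemma originn_in_Rn: "originn n \<in> Rn n"
  by (simp add: Rn_def)

lemma le_weighted_geometric_mean:
  fixes a b K :: real
  assumes "0 < K" "K \<le> a" "K \<le> b" "t \<in> {0..1}"
  shows "K \<le> a powr t * b powr (1 - t)"
proof -
  have "K = K powr t * K powr (1 - t)" using assms by (simp flip: powr_add)
  also have "\<dots> \<le> a powr t * b powr (1 - t)"
    using assms by (intro mult_mono powr_mono2) auto
  finally show ?thesis .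
qed

lemma isotropic_logconcave_densityD:
  assumes "isotropic_logconcave_density n f"
  shows "f \<in> borel_measurable (lebn n)"
    and "\<And>x. x \<in> Rn n \<Longrightarrow> 0 \<le> f x"
    and "integrable (lebn n) f" "(\<integral>x. f x \<partial>lebn n) = 1"
    and "\<And>x y t. x \<in> Rn n \<Longrightarrow> y \<in> Rn n \<Longrightarrow> t \<in> {0..1} \<Longrightarrow> f x powr t * f y powr (1 - t) \<le> f (combn n t x y)"
    and "\<And>i. i < n \<Longrightarrow> integrable (lebn n) (\<lambda>x. x i * f x)"
    and "\<And>i. i < n \<Longrightarrow> (\<integral>x. x i * f x \<partial>lebn n) = 0"
    and "\<And>i j. i < n \<Longrightarrow> j < n \<Longrightarrow> integrable (lebn n) (\<lambda>x. x i * x j * f x)"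
    and "\<And>i j. i < n \<Longrightarrow> j < n \<Longrightarrow> (\<integral>x. x i * x j * f x \<partial>lebn n) = (if i = j then 1 else 0)"
  using assms by (auto simp: isotropic_logconcave_density_def)

text \<open>Bernoulli's inequality, as 1 - (n + 1) / (4 n) is at least 1 / 2. The exponent
  \<open>Suc n\<close> covers the Jacobian of a contraction together with one further factor from a
  weight.\<close>

lemma contraction_factor_power:
  assumes "n \<ge> 1" "k \<le> Suc n"
  shows "1 / 2 \<le> (1 - 1 / (4 * real n)) ^ k"
proof -
  have x: "0 < 1 - 1 / (4 * real n)" "1 - 1 / (4 * real n) \<le> 1" using assms(1) by (auto simp: field_simps)
  have "1 / 2 \<le> 1 + real (Suc n) * (- 1 / (4 * real n))"
    using assms(1) by (simp add: field_simps)
  also have "\<dots> \<le> (1 + (- 1 / (4 * real n))) ^ Suc n"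
    using x by (intro Bernoulli_inequality) simp
  also have "\<dots> \<le> (1 - 1 / (4 * real n)) ^ k"
    using x assms(2) power_decreasing[of k "Suc n" "1 - 1 / (4 * real n)"] by simp
  finally show ?thesis .
qed

text \<open>With V = ln (f x0 / min f (f x0)), log-concavity along the segments to x0 gives
  f V <= f o T / l for the contraction T towards x0 with ratio 1 - l; here l = 1 / (4 n).\<close>
lemma weighted_entropy_bound:
  fixes f w :: "(nat \<Rightarrow> real) \<Rightarrow> real" and n :: nat
  defines "c \<equiv> 1 - 1 / (4 * real n)"
  assumes n: "n \<ge> 1" and f: "isotropic_logconcave_density n f"
    and x0: "x0 \<in> Rn n" "f x0 > 0"
    and w: "w \<in> borel_measurable (lebn n)" "\<And>x. x \<in> Rn n \<Longrightarrow> 0 \<le> w x"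
      "\<And>x. x \<in> Rn n \<Longrightarrow> c * w x \<le> w (combn n c x x0)"
    and wf: "integrable (lebn n) (\<lambda>x. w x * f x)"
  defines "V \<equiv> (\<lambda>x. ln (f x0) - ln (min (f x) (f x0)))"
  shows "integrable (lebn n) (\<lambda>x. w x * f x * V x)"
    and "(\<integral>x. w x * f x * V x \<partial>lebn n) \<le> 8 * real n * (\<integral>x. w x * f x \<partial>lebn n)"
proof -
  note F = isotropic_logconcave_densityD[OF f]
  note [measurable] = F(1) w(1)
  define l where "l = 1 / (4 * real n)"
  have l: "0 < l" "l < 1" "c = 1 - l" "0 < c" "c < 1"
    using n by (auto simp: l_def c_def field_simps)
  let ?F = "\<lambda>x. w x * f x"
  define G where "G = (\<lambda>x. ?F (combn n c x x0))"
  have G_int: "integrable (lebn n) G"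
    unfolding G_def combn_eq_aff using wf by (subst integrable_aff[OF l(4)]) auto
  have G_val: "(\<integral>x. ?F x \<partial>lebn n) = c ^ n * (\<integral>x. G x \<partial>lebn n)"
    unfolding G_def combn_eq_aff by (rule integral_aff[OF l(4)]) simp
  have G0: "0 \<le> G x" for x by (simp add: G_def w(2) F(2))
  have V0: "0 \<le> V x" if "0 < f x" for x
    using that x0(2) by (auto simp: V_def)
  have nonneg: "0 \<le> ?F x * V x" if "x \<in> Rn n" for x
    using w(2)[OF that] F(2)[OF that] V0[of x] by (cases "f x = 0") auto
  \<comment> \<open>\<open>x0\<close> is not assumed to maximise \<open>f\<close>: where
    \<open>f x\<close> is at least \<open>f x0\<close>, the truncation makes \<open>V\<close>
    vanish, and elsewhere log-concavity applies with weight \<open>c\<close>.\<close>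
  have fV: "f x * V x \<le> f (combn n c x x0) / l" if x: "x \<in> Rn n" for x
  proof (cases "f x = 0 \<or> f x \<ge> f x0")
    case True
    then have "f x * V x = 0" by (auto simp: V_def)
    moreover have "0 \<le> f (combn n c x x0) / l" using F(2)[OF combn_in_Rn] l by simp
    ultimately show ?thesis by (simp only:)
  next
    case False
    then have fx: "0 < f x" "f x < f x0" using F(2)[OF x] by auto
    then have V: "V x = ln (f x0) - ln (f x)" by (simp add: V_def)
    \<comment> \<open>Bounding \<open>l * V x\<close> by its exponential turns the logarithm into
      the factor (f x0 / f x)^l, which is what log-concavity between \<open>x\<close> and
      \<open>x0\<close> absorbs.\<close>
    have le_exp: "l * V x \<le> exp (l * V x)" using exp_ge_add_one_self[of "l * V x"] by linarith
    have "l * (f x * V x) = f x * (l * V x)" by simp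
    also have "\<dots> \<le> f x * exp (l * V x)"
      using fx le_exp by (intro mult_left_mono) auto
    also have "\<dots> = exp (ln (f x) + l * V x)" using fx by (simp add: exp_add)
    also have "ln (f x) + l * V x = c * ln (f x) + (1 - c) * ln (f x0)"
      by (simp add: V l(3) algebra_simps)
    also have "exp \<dots> = f x powr c * f x0 powr (1 - c)"
      using fx by (simp add: powr_def exp_add)
    also have "\<dots> \<le> f (combn n c x x0)" using F(5)[OF x x0(1), of c] l by auto
    finally show ?thesis using l(1) by (simp add: pos_le_divide_eq mult.commute)
  qed
  have ub: "?F x * V x \<le> G x / (l * c)" if x: "x \<in> Rn n" for x
  proof -
    have "?F x * V x = w x * (f x * V x)" by simp
    also have "\<dots> \<le> w x * (f (combn n c x x0) / l)"
      using fV[OF x] w(2)[OF x] by (rule mult_left_mono)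
    also have "\<dots> \<le> (w (combn n c x x0) / c) * (f (combn n c x x0) / l)"
      using w(3)[OF x] l(1,4) F(2)[OF combn_in_Rn]
      by (intro mult_right_mono) (auto simp: pos_le_divide_eq mult.commute)
    finally show ?thesis by (simp add: G_def mult_ac)
  qed
  show int: "integrable (lebn n) (\<lambda>x. ?F x * V x)"
  proof (rule Bochner_Integration.integrable_bound)
    show "integrable (lebn n) (\<lambda>x. G x / (l * c))" using G_int by simp
    show "AE x in lebn n. norm (?F x * V x) \<le> norm (G x / (l * c))"
    proof (rule AE_I2)
      fix x assume "x \<in> space (lebn n)"
      then have "0 \<le> ?F x * V x" "?F x * V x \<le> G x / (l * c)" using nonneg ub by auto
      then show "norm (?F x * V x) \<le> norm (G x / (l * c))" by (simp only: real_norm_def)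
    qed
  qed (simp add: V_def)
  have "(\<integral>x. ?F x * V x \<partial>lebn n) \<le> (\<integral>x. G x / (l * c) \<partial>lebn n)"
    using int G_int ub by (intro integral_mono) auto
  also have "\<dots> = (\<integral>x. G x \<partial>lebn n) / (l * c)" by simp
  \<comment> \<open>The Jacobian accounts for \<open>c ^ n\<close> and the weight for the last
    \<open>c\<close>. Together they cost at most a factor 2, and 1 / l is 4 n, whence 8 n.\<close>
  also have "\<dots> = (\<integral>x. ?F x \<partial>lebn n) / (l * c ^ Suc n)"
    using l by (simp add: G_val)
  also have "\<dots> \<le> (\<integral>x. ?F x \<partial>lebn n) / (l * (1 / 2))"
  proof (intro divide_left_mono mult_left_mono)
    show "1 / 2 \<le> c ^ Suc n" unfolding c_def by (rule contraction_factor_power[OF n]) simp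
    show "0 \<le> (\<integral>x. ?F x \<partial>lebn n)" using w(2) F(2) by (intro integral_nonneg_AE) auto
  qed (use l in auto)
  also have "\<dots> = 8 * real n * (\<integral>x. ?F x \<partial>lebn n)" using n by (simp add: l_def)
  finally show "(\<integral>x. ?F x * V x \<partial>lebn n) \<le> 8 * real n * (\<integral>x. ?F x \<partial>lebn n)" .
qed

text \<open>Jensen's inequality for the truncated logarithm \<open>u\<close> under the probability
  density \<open>w f / m\<close> with barycenter \<open>z\<close>: the entropy bound keeps the mean
  of \<open>u\<close> above \<open>ln (f x0) - 8 n\<close>. Jensen also places \<open>z\<close>
  where \<open>f\<close> is positive, so that \<open>ln\<close> is meaningful there.\<close>

lemma density_at_weighted_barycenter:
  fixes f w :: "(nat \<Rightarrow> real) \<Rightarrow> real" and n :: nat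
  defines "c \<equiv> 1 - 1 / (4 * real n)"
  assumes n: "n \<ge> 1" and f: "isotropic_logconcave_density n f"
    and x0: "x0 \<in> Rn n" "f x0 > 0"
    and w: "w \<in> borel_measurable (lebn n)" "\<And>x. x \<in> Rn n \<Longrightarrow> 0 \<le> w x"
      "\<And>x. x \<in> Rn n \<Longrightarrow> c * w x \<le> w (combn n c x x0)"
    and wf: "integrable (lebn n) (\<lambda>x. w x * f x)" "(\<integral>x. w x * f x \<partial>lebn n) = m" "0 < m"
    and z: "z \<in> Rn n" "\<And>i. i < n \<Longrightarrow> integrable (lebn n) (\<lambda>x. x i * (w x * f x))"
      "\<And>i. i < n \<Longrightarrow> (\<integral>x. x i * (w x * f x) \<partial>lebn n) = m * z i"
  shows "exp (- 8 * real n) * f x0 \<le> f z"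
proof -
  note F = isotropic_logconcave_densityD[OF f]
  define u where "u = (\<lambda>x. ln (min (f x) (f x0)))"
  define P where "P = {x \<in> Rn n. 0 < f x}"
  define p where "p = (\<lambda>x. w x * f x / m)"
  have E: "integrable (lebn n) (\<lambda>x. w x * f x * (ln (f x0) - u x))"
    "(\<integral>x. w x * f x * (ln (f x0) - u x) \<partial>lebn n) \<le> 8 * real n * m"
    using weighted_entropy_bound[OF n f x0 w[unfolded c_def] wf(1)] wf(2) by (simp_all add: u_def)
  have pu: "p x * u x = (ln (f x0) * (w x * f x) - w x * f x * (ln (f x0) - u x)) / m" for x
    using wf(3) by (simp add: p_def field_simps)
  have "z \<in> P \<and> (\<integral>x. p x * u x \<partial>lebn n) \<le> u z"
  proof (rule jensen_concave_lebn)
    fix x y t assume xy: "x \<in> P" "y \<in> P" and t: "t \<in> {0..1::real}"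
    define a b where "a = min (f x) (f x0)" and "b = min (f y) (f x0)"
    \<comment> \<open>Truncation preserves log-concavity: the geometric mean of the truncated values
      lies below both \<open>f\<close> at the combination and \<open>f x0\<close>.\<close>
    let ?g = "a powr t * b powr (1 - t)"
    have pos: "0 < a" "0 < b" and le: "a \<le> f x" "a \<le> f x0" "b \<le> f y" "b \<le> f x0"
      using xy x0 by (auto simp: P_def a_def b_def)
    have "?g \<le> f x powr t * f y powr (1 - t)"
      using pos le t by (intro mult_mono powr_mono2) auto
    also have "\<dots> \<le> f (combn n t x y)" using xy t F(5) by (simp add: P_def)
    finally have g1: "?g \<le> f (combn n t x y)" .
    have "?g \<le> f x0 powr t * f x0 powr (1 - t)"
      using pos le t by (intro mult_mono powr_mono2) auto
    also have "\<dots> = f x0" using x0 by (simp flip: powr_add)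
    finally have g2: "?g \<le> f x0" .
    have g0: "0 < ?g" using pos by simp
    have "t * u x + (1 - t) * u y = ln ?g"
      using pos by (simp add: u_def ln_mult ln_powr flip: a_def b_def)
    also have "\<dots> \<le> u (combn n t x y)"
      unfolding u_def using g0 g1 g2 by (subst ln_le_cancel_iff) auto
    finally show "combn n t x y \<in> P \<and> t * u x + (1 - t) * u y \<le> u (combn n t x y)"
      using g0 g1 by (auto simp: P_def)
  next
    fix i assume "i < n"
    have eq: "x i * p x = x i * (w x * f x) / m" for x by (simp add: p_def)
    show "integrable (lebn n) (\<lambda>x. x i * p x)" "(\<integral>x. x i * p x \<partial>lebn n) = z i"
      unfolding eq using z(2,3)[OF \<open>i < n\<close>] wf(3) by simp_all
  next
    show "integrable (lebn n) (\<lambda>x. p x * u x)"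
      unfolding pu using E(1) wf(1)
      by (intro integrable_divide_zero Bochner_Integration.integrable_diff integrable_mult_right) auto
  qed (use wf z w(2) F(2) in \<open>auto simp: p_def P_def less_le\<close>)
  moreover have "(\<integral>x. p x * u x \<partial>lebn n) \<ge> ln (f x0) - 8 * real n"
  proof -
    have "(\<integral>x. p x * u x \<partial>lebn n)
        = (ln (f x0) * m - (\<integral>x. w x * f x * (ln (f x0) - u x) \<partial>lebn n)) / m"
      unfolding pu integral_divide_zero
      by (subst Bochner_Integration.integral_diff) (use E(1) wf in auto)
    also have "\<dots> \<ge> (ln (f x0) * m - 8 * real n * m) / m"
      using E(2) wf(3) by (intro divide_right_mono) auto
    finally show ?thesis using wf(3) by (simp add: diff_divide_distrib)
  qed
  ultimately have "0 < f z" "ln (f x0) - 8 * real n \<le> ln (min (f z) (f x0))" by (auto simp: P_def u_def)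
  then have "exp (ln (f x0) - 8 * real n) \<le> min (f z) (f x0)"
    using x0(2) by (subst ln_ge_iff[symmetric]) auto
  then show ?thesis using x0(2) by (simp add: exp_diff exp_minus field_simps)
qed

text \<open>The weight 1 has barycenter 0 because \<open>f\<close> is centered. Since
  \<open>x\<close> itself takes the place of \<open>x0\<close>, every value of \<open>f\<close> is
  covered, whether or not a maximum exists.\<close>

lemma density_le_origin:
  assumes n: "n \<ge> 1" and f: "isotropic_logconcave_density n f" and x: "x \<in> Rn n"
  shows "f x \<le> exp (8 * real n) * f (originn n)"
proof (cases "f x = 0")
  case True
  then show ?thesis using isotropic_logconcave_densityD(2)[OF f originn_in_Rn] by simp
next
  case False
  note F = isotropic_logconcave_densityD[OF f]
  have "exp (- 8 * real n) * f x \<le> f (originn n)"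
    using False F(2)[OF x] n F(3,4,6,7) x
    by (intro density_at_weighted_barycenter[OF n f x, where w = "\<lambda>_. 1" and m = 1])
       (auto simp: originn_in_Rn field_simps)
  then show ?thesis by (simp add: exp_minus field_simps)
qed

lemma density_origin_pos:
  assumes n: "n \<ge> 1" and f: "isotropic_logconcave_density n f"
  shows "0 < f (originn n)"
proof (rule ccontr)
  assume "\<not> ?thesis"
  then have 0: "f (originn n) \<le> 0" by simp
  note F = isotropic_logconcave_densityD[OF f]
  have "f x = 0" if "x \<in> Rn n" for x
  proof -
    have "f x \<le> exp (8 * real n) * f (originn n)" by (rule density_le_origin[OF n f that])
    also have "\<dots> \<le> 0" using 0 by (simp add: mult_nonneg_nonpos)
    finally show ?thesis using F(2)[OF that] by simp
  qed
  then have "(\<integral>x. f x \<partial>lebn n) = (\<integral>x. 0 \<partial>lebn n)"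
    by (intro Bochner_Integration.integral_cong) auto
  then show False using F(4) by simp
qed

text \<open>The mixed moments, equal to \<open>\<theta> i\<close>, are what makes the barycenters
  weighted by the two parts of \<open>X\<close> differ along \<open>\<theta>\<close>; the second
  moment bounds the mean of |X|.\<close>

lemma isotropic_linear_functional:
  fixes \<theta> :: "nat \<Rightarrow> real"
  assumes f: "isotropic_logconcave_density n f"
  defines "X \<equiv> (\<lambda>x. \<Sum>i<n. \<theta> i * x i)"
  shows "integrable (lebn n) (\<lambda>x. X x * f x)" "(\<integral>x. X x * f x \<partial>lebn n) = 0"
    and "i < n \<Longrightarrow> integrable (lebn n) (\<lambda>x. X x * x i * f x)"
    and "i < n \<Longrightarrow> (\<integral>x. X x * x i * f x \<partial>lebn n) = \<theta> i"
    and "integrable (lebn n) (\<lambda>x. (X x)\<^sup>2 * f x)"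
    and "(\<integral>x. (X x)\<^sup>2 * f x \<partial>lebn n) = (\<Sum>i<n. (\<theta> i)\<^sup>2)"
proof -
  note F = isotropic_logconcave_densityD[OF f]
  have 1: "X x * f x = (\<Sum>i<n. \<theta> i * (x i * f x))" for x
    by (simp add: X_def sum_distrib_right mult.assoc)
  show "integrable (lebn n) (\<lambda>x. X x * f x)" "(\<integral>x. X x * f x \<partial>lebn n) = 0"
    unfolding 1 using F(6,7) by auto
  have 2: "X x * x i * f x = (\<Sum>j<n. \<theta> j * (x j * x i * f x))" for x i
    by (simp add: X_def sum_distrib_left sum_distrib_right mult_ac)
  show A: "integrable (lebn n) (\<lambda>x. X x * x i * f x)" if "i < n" for i
    unfolding 2 using F(8) that by auto
  show B: "(\<integral>x. X x * x i * f x \<partial>lebn n) = \<theta> i" if "i < n" for i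
  proof -
    have "(\<integral>x. X x * x i * f x \<partial>lebn n) = (\<Sum>j<n. \<theta> j * (if j = i then 1 else 0))"
      unfolding 2 using F(8,9) that by (subst Bochner_Integration.integral_sum) auto
    also have "\<dots> = (\<Sum>j<n. if j = i then \<theta> j else 0)" by (intro sum.cong) auto
    also have "\<dots> = \<theta> i" using that by simp
    finally show ?thesis .
  qed
  have 3: "(X x)\<^sup>2 * f x = (\<Sum>i<n. \<theta> i * (X x * x i * f x))" for x
  proof -
    have "(X x)\<^sup>2 * f x = (\<Sum>i<n. \<theta> i * x i) * (X x * f x)"
      by (simp add: power2_eq_square X_def)
    also have "\<dots> = (\<Sum>i<n. \<theta> i * x i * (X x * f x))" by (rule sum_distrib_right)
    finally show ?thesis by (simp add: mult_ac)
  qed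
  show "integrable (lebn n) (\<lambda>x. (X x)\<^sup>2 * f x)"
    unfolding 3 using A by auto
  show "(\<integral>x. (X x)\<^sup>2 * f x \<partial>lebn n) = (\<Sum>i<n. (\<theta> i)\<^sup>2)"
    unfolding 3 using A B by (subst Bochner_Integration.integral_sum) (auto simp: power2_eq_square)
qed

text \<open>The two densities proportional to f X_+ and f X_- have barycenters differing by
  theta / E X_+, by isotropy, and f is large at both.\<close>
lemma high_density_segment:
  fixes \<theta> :: "nat \<Rightarrow> real"
  assumes n: "n \<ge> 1" and f: "isotropic_logconcave_density n f"
    and \<theta>: "(\<Sum>i<n. (\<theta> i)\<^sup>2) = 1"
  shows "\<exists>z\<in>Rn n. \<forall>s\<in>{0..2}. \<forall>x\<in>Rn n. exp (- 16 * real n) * f x \<le> f (aff n 1 (\<lambda>i. s * \<theta> i) z)"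
proof -
  note F = isotropic_logconcave_densityD[OF f]
  define X where "X x = (\<Sum>i<n. \<theta> i * x i)" for x
  note X = isotropic_linear_functional[OF f, where \<theta> = \<theta>, folded X_def, unfolded \<theta>]
  have [measurable]: "X \<in> borel_measurable (lebn n)" "f \<in> borel_measurable (lebn n)"
    using F(1) unfolding X_def[abs_def] by measurable
  define w where "w = (\<lambda>\<sigma> x. max 0 (\<sigma> * X x))"
  define m where "m = (\<integral>x. w 1 x * f x \<partial>lebn n)"
  have w_meas [measurable]: "w \<sigma> \<in> borel_measurable (lebn n)" for \<sigma>
    unfolding w_def by measurable
  have w0: "0 \<le> w \<sigma> x" for \<sigma> x by (simp add: w_def)
  have w_le: "w \<sigma> x \<le> \<bar>X x\<bar>" if "\<bar>\<sigma>\<bar> = 1" for \<sigma> x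
    using that by (auto simp: w_def abs_if split: if_splits)
  have diff: "w 1 x - w (- 1) x = X x" and abs_X: "\<bar>X x\<bar> = w 1 x + w (- 1) x" for x
    by (auto simp: w_def)
  have wf: "integrable (lebn n) (\<lambda>x. w \<sigma> x * f x)" if \<sigma>: "\<bar>\<sigma>\<bar> = 1" for \<sigma>
  proof (rule Bochner_Integration.integrable_bound[OF X(1)])
    show "AE x in lebn n. norm (w \<sigma> x * f x) \<le> norm (X x * f x)"
      using w_le[OF \<sigma>] w0 by (intro AE_I2) (auto simp: abs_mult intro!: mult_right_mono)
  qed measurable
  have xwf: "integrable (lebn n) (\<lambda>x. x i * (w \<sigma> x * f x))" if \<sigma>: "\<bar>\<sigma>\<bar> = 1" and i: "i < n" for \<sigma> i
  proof (rule Bochner_Integration.integrable_bound[OF X(3)[OF i]])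
    show "AE x in lebn n. norm (x i * (w \<sigma> x * f x)) \<le> norm (X x * x i * f x)"
    proof (rule AE_I2)
      fix x
      have "\<bar>w \<sigma> x\<bar> * \<bar>x i * f x\<bar> \<le> \<bar>X x\<bar> * \<bar>x i * f x\<bar>"
        using w_le[OF \<sigma>, of x] w0[of \<sigma> x] by (intro mult_right_mono) auto
      then show "norm (x i * (w \<sigma> x * f x)) \<le> norm (X x * x i * f x)"
        by (simp add: abs_mult mult_ac)
    qed
  qed (use i in measurable)
  have diff_int: "m - (\<integral>x. w (- 1) x * f x \<partial>lebn n) = 0"
  proof -
    have "m - (\<integral>x. w (- 1) x * f x \<partial>lebn n) = (\<integral>x. w 1 x * f x - w (- 1) x * f x \<partial>lebn n)"
      unfolding m_def using wf by (subst Bochner_Integration.integral_diff) auto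
    also have "\<dots> = (\<integral>x. X x * f x \<partial>lebn n)"
      by (simp flip: left_diff_distrib add: diff)
    finally show ?thesis using X(2) by simp
  qed
  have w_int: "(\<integral>x. w \<sigma> x * f x \<partial>lebn n) = m" if "\<sigma> = 1 \<or> \<sigma> = - 1" for \<sigma>
    using that diff_int by (auto simp: m_def)
  have absX_int: "integrable (lebn n) (\<lambda>x. \<bar>X x\<bar> * f x)"
    unfolding abs_X distrib_right using wf by (intro Bochner_Integration.integrable_add) auto
  have absX_val: "(\<integral>x. \<bar>X x\<bar> * f x \<partial>lebn n) = 2 * m"
    unfolding abs_X distrib_right
    by (subst Bochner_Integration.integral_add) (use wf w_int in auto)
  have "m \<ge> 0" unfolding m_def using w0 F(2) by (intro integral_nonneg_AE) auto
  moreover have "m \<noteq> 0"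
  proof
    assume "m = 0"
    then have "AE x in lebn n. \<bar>X x\<bar> * f x = 0"
      using absX_int absX_val F(2) by (subst integral_nonneg_eq_0_iff_AE[symmetric]) auto
    then have "AE x in lebn n. (X x)\<^sup>2 * f x = 0" by eventually_elim auto
    then have "(\<integral>x. (X x)\<^sup>2 * f x \<partial>lebn n) = 0" by (rule integral_eq_zero_AE)
    then show False using X(6) by simp
  qed
  ultimately have m0: "0 < m" by simp
  \<comment> \<open>From |X| <= (1 + X^2) / 2 and unit variance, the mean of |X| is at most 1. Hence
    1 / m, the distance between the two barycenters, is at least 2.\<close>
  have "2 * m \<le> (\<integral>x. (f x + (X x)\<^sup>2 * f x) / 2 \<partial>lebn n)"
    unfolding absX_val[symmetric]
  proof (rule integral_mono)
    fix x assume "x \<in> space (lebn n)"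
    have "\<bar>X x\<bar> \<le> (1 + (X x)\<^sup>2) / 2"
      using zero_le_power2[of "\<bar>X x\<bar> - 1"] by (simp add: power2_diff)
    then have "\<bar>X x\<bar> * f x \<le> (1 + (X x)\<^sup>2) / 2 * f x"
      using F(2) \<open>x \<in> space (lebn n)\<close> by (intro mult_right_mono) auto
    then show "\<bar>X x\<bar> * f x \<le> (f x + (X x)\<^sup>2 * f x) / 2" by (simp add: field_simps)
  qed (use absX_int F(3) X(5) in auto)
  also have "\<dots> = 1" using F(3,4) X(5,6) by simp
  finally have m1: "m \<le> 1 / 2" by simp
  define z where "z = (\<lambda>\<sigma>. restrict (\<lambda>i. (\<integral>x. x i * (w \<sigma> x * f x) \<partial>lebn n) / m) {..<n})"
  have z_Rn: "z \<sigma> \<in> Rn n" for \<sigma> by (auto simp: z_def Rn_def)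
  let ?K = "exp (- 8 * real n) * f (originn n)"
  have high: "?K \<le> f (z \<sigma>)" if \<sigma>: "\<sigma> = 1 \<or> \<sigma> = - 1" for \<sigma>
  proof (rule density_at_weighted_barycenter[OF n f originn_in_Rn density_origin_pos[OF n f] w_meas])
    define c where "c = 1 - 1 / (4 * real n)"
    have "0 \<le> c" using n by (simp add: c_def field_simps)
    fix x
    \<comment> \<open>\<open>w\<close> is positively homogeneous, so the contraction condition on
      the weight holds with equality at the origin.\<close>
    have "X (combn n c x (originn n)) = c * X x"
      unfolding X_def sum_distrib_left by (intro sum.cong) (auto simp: combn_def)
    then have "w \<sigma> (combn n c x (originn n)) = c * w \<sigma> x"
      using \<open>0 \<le> c\<close> by (auto simp: w_def max_def zero_le_mult_iff mult_le_0_iff algebra_simps)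
    then show "(1 - 1 / (4 * real n)) * w \<sigma> x \<le> w \<sigma> (combn n (1 - 1 / (4 * real n)) x (originn n))"
      by (simp add: c_def)
  next
    show "\<And>i. i < n \<Longrightarrow> (\<integral>x. x i * (w \<sigma> x * f x) \<partial>lebn n) = m * z \<sigma> i"
      using m0 by (simp add: z_def)
  qed (use \<sigma> w0 wf w_int m0 z_Rn xwf in auto)
  have z_diff: "z 1 i - z (- 1) i = \<theta> i / m" if i: "i < n" for i
  proof -
    have "(\<integral>x. x i * (w 1 x * f x) \<partial>lebn n) - (\<integral>x. x i * (w (- 1) x * f x) \<partial>lebn n)
        = (\<integral>x. x i * (w 1 x * f x) - x i * (w (- 1) x * f x) \<partial>lebn n)"
      using xwf[OF _ i] by (subst Bochner_Integration.integral_diff) auto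
    also have "\<dots> = (\<integral>x. X x * x i * f x \<partial>lebn n)"
    proof (intro Bochner_Integration.integral_cong refl)
      fix x
      have "x i * (w 1 x * f x) - x i * (w (- 1) x * f x) = (w 1 x - w (- 1) x) * x i * f x"
        by (simp add: algebra_simps)
      then show "x i * (w 1 x * f x) - x i * (w (- 1) x * f x) = X x * x i * f x" by (simp only: diff)
    qed
    also have "\<dots> = \<theta> i" by (rule X(4)[OF i])
    finally show ?thesis using i by (simp add: z_def flip: diff_divide_distrib)
  qed
  show ?thesis
  proof (intro bexI[of _ "z (- 1)"] ballI z_Rn)
    fix s x assume s: "s \<in> {0..2::real}" and x: "x \<in> Rn n"
    \<comment> \<open>The segment runs from \<open>z (- 1)\<close> to \<open>z 1\<close>; an offset
      \<open>s\<close> along \<open>\<theta>\<close> is the fraction \<open>s * m\<close> of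
      it.\<close>
    have t: "s * m \<in> {0..1}"
    proof -
      have "s * m \<le> 2 * (1 / 2)" using s m0 m1 by (intro mult_mono) auto
      then show ?thesis using s m0 by simp
    qed
    have "aff n 1 (\<lambda>i. s * \<theta> i) (z (- 1)) = combn n (s * m) (z 1) (z (- 1))"
      unfolding aff_def combn_def
    proof (rule restrict_ext)
      fix i assume "i \<in> {..<n}"
      then have "z 1 i = z (- 1) i + \<theta> i / m" using z_diff[of i] by simp
      then show "1 * z (- 1) i + s * \<theta> i = s * m * z 1 i + (1 - s * m) * z (- 1) i"
        using m0 by (simp add: algebra_simps)
    qed
    then have eq: "f (aff n 1 (\<lambda>i. s * \<theta> i) (z (- 1))) = f (combn n (s * m) (z 1) (z (- 1)))" by simp
    \<comment> \<open>One loss of exp (8 n) occurs between an arbitrary point and the origin, a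
      second between the origin and the two barycenters.\<close>
    have "exp (- 16 * real n) * f x \<le> exp (- 16 * real n) * (exp (8 * real n) * f (originn n))"
      using density_le_origin[OF n f x] by (intro mult_left_mono) auto
    also have "\<dots> = ?K" by (simp flip: mult.assoc exp_add)
    also have "?K \<le> f (z 1) powr (s * m) * f (z (- 1)) powr (1 - s * m)"
      using high t density_origin_pos[OF n f] by (intro le_weighted_geometric_mean) auto
    also have "\<dots> \<le> f (combn n (s * m) (z 1) (z (- 1)))" using t by (intro F(5) z_Rn)
    finally show "exp (- 16 * real n) * f x \<le> f (aff n 1 (\<lambda>i. s * \<theta> i) (z (- 1)))"
      unfolding eq .
  qed
qed

section \<open>Layers in a fixed direction\<close>

lemma combn_inverse:
  assumes "c \<noteq> 0" "x \<in> Rn n"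
  shows "combn n (1 / c) (combn n c x z) z = x"
proof -
  have "combn n (1 / c) (combn n c x z) z = restrict x {..<n}"
    unfolding combn_def using assms(1) by (intro restrict_ext) (simp add: field_simps)
  then show ?thesis using assms(2) by (simp add: Rn_def PiE_restrict)
qed

lemma sum_indicator_le_1:
  assumes "finite K" "\<And>j k. j \<in> K \<Longrightarrow> k \<in> K \<Longrightarrow> Q j \<in> D \<Longrightarrow> Q k \<in> D \<Longrightarrow> j = k"
  shows "(\<Sum>k\<in>K. indicator D (Q k)) \<le> (1 :: ennreal)"
proof (cases "\<exists>k\<in>K. Q k \<in> D")
  case True
  then obtain k0 where k0: "k0 \<in> K" "Q k0 \<in> D" by blast
  have "Q k \<in> D \<longleftrightarrow> k = k0" if "k \<in> K" for k
    using assms(2)[OF that k0(1)] k0(2) by blast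
  then have "(\<Sum>k\<in>K. indicator D (Q k)) = (\<Sum>k\<in>K. if k = k0 then 1 else (0 :: ennreal))"
    by (intro sum.cong) (simp_all add: indicator_def)
  then show ?thesis using assms(1) k0 by simp
next
  case False
  then have "(\<Sum>k\<in>K. indicator D (Q k)) = (\<Sum>k\<in>K. (0 :: ennreal))"
    by (intro sum.cong) auto
  then show ?thesis by simp
qed

text \<open>Contract D towards equally spaced points of the segment on which f is large. The copies
  lie at spacing (1 - l) d along theta, hence are disjoint by convexity of E, and each
  carries a fixed proportion of the mass of D.\<close>
lemma mass_of_directional_layer:
  fixes \<theta> :: "nat \<Rightarrow> real" and \<delta> :: real
  assumes n: "n \<ge> 1" and f: "isotropic_logconcave_density n f"
    and \<theta>: "(\<Sum>i<n. (\<theta> i)\<^sup>2) = 1" and \<delta>: "\<delta> > 0"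
    and E [measurable]: "E \<in> sets (lebn n)" and conv: "convex_n n E"
  defines "D \<equiv> {x \<in> E. aff n 1 (\<lambda>i. \<delta> * \<theta> i) x \<notin> E}"
  shows "D \<in> sets (lebn n)"
    and "(\<integral>\<^sup>+x. ennreal (f x) * indicator D x \<partial>lebn n) \<le> ennreal (4 * exp 4 * real n * \<delta>)"
proof -
  note F = isotropic_logconcave_densityD[OF f]
  note [measurable] = F(1)
  have D_eq: "D = {x \<in> space (lebn n). x \<in> E \<and> aff n 1 (\<lambda>i. \<delta> * \<theta> i) x \<notin> E}"
    using sets.sets_into_space[OF E] by (auto simp: D_def)
  show D [measurable]: "D \<in> sets (lebn n)"
    unfolding D_eq by measurable
  define l where "l = 1 / (4 * real n)"
  define c where "c = 1 - l"
  have l: "0 < l" "l < 1" "0 < c" "c < 1" using n by (auto simp: l_def c_def field_simps)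
  \<comment> \<open>Moving a center by \<open>\<eta>\<close> moves its copy by
    \<open>l * \<eta> = c * \<delta>\<close>, which becomes exactly \<open>\<delta>\<close> once the
    contraction is undone.\<close>
  define \<eta> where "\<eta> = \<delta> * c / l"
  have \<eta>: "0 < \<eta>" using l \<delta> by (simp add: \<eta>_def)
  obtain z where z: "z \<in> Rn n" and high:
    "\<And>s x. 0 \<le> s \<Longrightarrow> s \<le> 2 \<Longrightarrow> x \<in> Rn n \<Longrightarrow> exp (- 16 * real n) * f x \<le> f (aff n 1 (\<lambda>i. s * \<theta> i) z)"
    using high_density_segment[OF n f \<theta>] by auto
  define Z where "Z = (\<lambda>k::nat. aff n 1 (\<lambda>i. real k * \<eta> * \<theta> i) z)"
  \<comment> \<open>The number of multiples of \<open>\<eta>\<close> in \<open>{0..2}\<close>,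
    counting 0: at least \<open>2 / \<eta>\<close>, and at least one however large
    \<open>\<delta>\<close> is.\<close>
  define N where "N = Suc (nat \<lfloor>2 / \<eta>\<rfloor>)"
  have N: "2 / \<eta> \<le> real N" "0 < N" unfolding N_def using \<eta> by linarith+
  have kN: "0 \<le> real k * \<eta> \<and> real k * \<eta> \<le> 2" if "k < N" for k
  proof -
    have "k \<le> nat \<lfloor>2 / \<eta>\<rfloor>" using that by (simp add: N_def)
    moreover have "real (nat \<lfloor>2 / \<eta>\<rfloor>) \<le> 2 / \<eta>" using \<eta> by (intro of_nat_floor) simp
    ultimately have "real k \<le> 2 / \<eta>" by linarith
    then show ?thesis using \<eta> by (simp add: field_simps)
  qed
  let ?M = "\<integral>\<^sup>+x. ennreal (f x) * indicator D x \<partial>lebn n"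
  \<comment> \<open>The preimage of \<open>y\<close> under the \<open>k\<close>-th contraction,
    obtained by extrapolating from its center; it lies in \<open>D\<close> when \<open>y\<close>
    lies in the \<open>k\<close>-th copy.\<close>
  define Q where "Q = (\<lambda>y k. combn n (1 / c) y (Z k))"
  have "AE x in lebn n. 0 \<le> f x" using F(2) by (intro AE_I2) simp
  then have f_int: "(\<integral>\<^sup>+x. ennreal (f x) \<partial>lebn n) = 1"
    using nn_integral_eq_integral[OF F(3)] F(4) by simp
  have copy: "ennreal (c ^ n * exp (- 4)) * ?M \<le> (\<integral>\<^sup>+y. ennreal (f y) * indicator D (Q y k) \<partial>lebn n)"
    if k: "k < N" for k
  proof -
    have fZ: "exp (- 4) * f x \<le> f (combn n c x (Z k))" if x: "x \<in> Rn n" for x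
    proof (cases "f x = 0")
      case True
      then show ?thesis using F(2)[OF combn_in_Rn] by simp
    next
      case False
      then have fx: "0 < f x" using F(2)[OF x] by simp
      have "exp (- 4) * f x = f x powr c * (exp (- 16 * real n) * f x) powr (1 - c)"
      proof -
        \<comment> \<open>\<open>1 - c\<close> is 1 / (4 n), so the exponential loss on the segment
          shrinks to a constant.\<close>
        have "exp (- 16 * real n) powr (1 - c) = exp (- 4)"
          using n by (simp add: powr_def c_def l_def)
        then have "(exp (- 16 * real n) * f x) powr (1 - c) = exp (- 4) * f x powr (1 - c)"
          using fx by (simp only: powr_mult)
        then show ?thesis using fx by (simp add: mult.left_commute flip: powr_add)
      qed
      also have "\<dots> \<le> f x powr c * f (Z k) powr (1 - c)"
        unfolding Z_def using high[of "real k * \<eta>" x] kN[OF k] x fx l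
        by (intro mult_left_mono powr_mono2) auto
      also have "\<dots> \<le> f (combn n c x (Z k))"
        using l x by (intro F(5)) (auto simp: Z_def)
      finally show ?thesis .
    qed
    have "ennreal (c ^ n * exp (- 4)) * ?M
        = ennreal (c ^ n) * (\<integral>\<^sup>+x. ennreal (exp (- 4)) * (ennreal (f x) * indicator D x) \<partial>lebn n)"
      using l by (simp add: nn_integral_cmult ennreal_mult mult.assoc)
    also have "\<dots> \<le> ennreal (c ^ n) * (\<integral>\<^sup>+x. ennreal (f (combn n c x (Z k))) * indicator D (Q (combn n c x (Z k)) k) \<partial>lebn n)"
    proof (intro mult_left_mono nn_integral_mono)
      fix x assume "x \<in> space (lebn n)"
      then have x: "x \<in> Rn n" by simp
      have "Q (combn n c x (Z k)) k = x"
        unfolding Q_def using l x by (intro combn_inverse) auto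
      moreover have "ennreal (exp (- 4)) * ennreal (f x) \<le> ennreal (f (combn n c x (Z k)))"
        using fZ[OF x] F(2)[OF x] by (simp add: ennreal_leI flip: ennreal_mult)
      ultimately show "ennreal (exp (- 4)) * (ennreal (f x) * indicator D x)
          \<le> ennreal (f (combn n c x (Z k))) * indicator D (Q (combn n c x (Z k)) k)"
        by (simp add: indicator_def)
    qed simp
    also have "\<dots> = (\<integral>\<^sup>+y. ennreal (f y) * indicator D (Q y k) \<partial>lebn n)"
      unfolding combn_eq_aff[of n c]
      by (subst nn_integral_aff[OF l(3), of "\<lambda>y. ennreal (f y) * indicator D (Q y k)", symmetric])
         (auto simp: Q_def)
    finally show ?thesis .
  qed
  have disj: "(\<Sum>k<N. indicator D (Q y k)) \<le> (1 :: ennreal)" for y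
  proof (rule sum_indicator_le_1)
    have Q_i: "Q y k i = y i / c + (1 - 1 / c) * z i - real k * \<delta> * \<theta> i" if "i < n" for k i
    proof -
      have "(1 - 1 / c) * \<eta> = - \<delta>" using l by (simp add: \<eta>_def c_def field_simps)
      moreover have "Q y k i = y i / c + (1 - 1 / c) * z i + real k * ((1 - 1 / c) * \<eta>) * \<theta> i"
        using that by (simp add: Q_def Z_def combn_def aff_def algebra_simps add_divide_distrib)
      ultimately show ?thesis by simp
    qed
    have no: False if jk: "j < k" "Q y j \<in> D" "Q y k \<in> D" for j k
    proof -
      \<comment> \<open>\<open>Q y j\<close> is \<open>Q y k\<close> moved by
        \<open>(k - j) * \<delta>\<close> along \<open>\<theta>\<close>, so one step of length
        \<open>\<delta>\<close> from \<open>Q y k\<close> stays on the segment between two points of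
        \<open>E\<close>, although a point of \<open>D\<close> leaves \<open>E\<close> in one
        step.\<close>
      define t where "t = 1 / (real k - real j)"
      have t: "t \<in> {0..1}" "t * (real k - real j) = 1" using jk(1) by (auto simp: t_def)
      have "aff n 1 (\<lambda>i. \<delta> * \<theta> i) (Q y k) = combn n t (Q y j) (Q y k)"
        unfolding aff_def combn_def
      proof (rule restrict_ext)
        fix i assume "i \<in> {..<n}"
        then have i: "i < n" by simp
        have "t * Q y j i + (1 - t) * Q y k i = Q y k i + t * (Q y j i - Q y k i)" by (simp add: algebra_simps)
        also have "Q y j i - Q y k i = (real k - real j) * (\<delta> * \<theta> i)" by (simp add: Q_i[OF i] algebra_simps)
        also have "t * \<dots> = \<delta> * \<theta> i" using t(2) by (simp flip: mult.assoc)
        finally show "1 * Q y k i + \<delta> * \<theta> i = t * Q y j i + (1 - t) * Q y k i" by simp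
      qed
      also have "\<dots> \<in> E" using conv jk t(1) by (auto simp: convex_n_def D_def)
      finally show False using jk(3) by (simp add: D_def)
    qed
    show "j = k" if "Q y j \<in> D" "Q y k \<in> D" for j k
      using no[of j k] no[of k j] that by (cases j k rule: linorder_cases) auto
  qed simp
  have "of_nat N * (ennreal (c ^ n * exp (- 4)) * ?M) = (\<Sum>k<N. ennreal (c ^ n * exp (- 4)) * ?M)"
    by simp
  also have "\<dots> \<le> (\<Sum>k<N. \<integral>\<^sup>+y. ennreal (f y) * indicator D (Q y k) \<partial>lebn n)"
    using copy by (intro sum_mono) auto
  also have "\<dots> = (\<integral>\<^sup>+y. ennreal (f y) * (\<Sum>k<N. indicator D (Q y k)) \<partial>lebn n)"
    unfolding sum_distrib_left Q_def by (subst nn_integral_sum) auto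
  also have "\<dots> \<le> (\<integral>\<^sup>+y. ennreal (f y) * 1 \<partial>lebn n)"
    using disj by (intro nn_integral_mono mult_left_mono) auto
  also have "\<dots> = 1" using f_int by simp
  finally have total: "of_nat N * (ennreal (c ^ n * exp (- 4)) * ?M) \<le> 1" .
  have "?M \<le> (\<integral>\<^sup>+x. ennreal (f x) * 1 \<partial>lebn n)"
    by (intro nn_integral_mono mult_left_mono) (auto simp: indicator_def)
  then have "?M \<le> 1" using f_int by simp
  then obtain r where r: "0 \<le> r" "?M = ennreal r"
    by (cases ?M) (auto simp: top_unique)
  have "real N * (c ^ n * exp (- 4) * r) \<le> 1"
    using total r l by (simp add: ennreal_of_nat_eq_real_of_nat flip: ennreal_mult)
  moreover have "2 / \<eta> * (1 / 2 * exp (- 4) * r) \<le> real N * (c ^ n * exp (- 4) * r)"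
    using N(1) contraction_factor_power[OF n, of n] r(1) \<eta> unfolding c_def l_def
    by (intro mult_mono) auto
  ultimately have "2 / \<eta> * (1 / 2 * exp (- 4) * r) \<le> 1" by linarith
  then have "r \<le> exp 4 * \<eta>"
    using \<eta> by (simp add: exp_minus field_simps)
  also have "\<dots> \<le> exp 4 * (4 * real n * \<delta>)"
    using l \<delta> n by (intro mult_left_mono) (auto simp: \<eta>_def l_def)
  finally show "?M \<le> ennreal (4 * exp 4 * real n * \<delta>)"
    unfolding r(2) by (intro ennreal_leI) (simp add: mult_ac)
qed

section \<open>Random sign directions\<close>

text \<open>Subsets index sign vectors: an expectation over random signs is a finite sum over
  \<open>Pow F\<close> divided by \<open>2 ^ card F\<close>, and induction on \<open>F\<close> adds
  one sign at a time.\<close>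

definition sign_of :: "nat set \<Rightarrow> nat \<Rightarrow> real" where
  "sign_of T i = (if i \<in> T then 1 else - 1)"

lemma sum_Pow_insert:
  fixes g :: "'a set \<Rightarrow> 'b::comm_monoid_add"
  assumes "finite F" "a \<notin> F"
  shows "(\<Sum>T\<in>Pow (insert a F). g T) = (\<Sum>T\<in>Pow F. g T + g (insert a T))"
proof -
  have "inj_on (insert a) (Pow F)" using assms(2) by (auto simp: inj_on_def)
  moreover have "Pow F \<inter> insert a ` Pow F = {}" using assms(2) by auto
  ultimately show ?thesis
    using assms(1) by (simp add: Pow_insert sum.union_disjoint sum.reindex sum.distrib)
qed

text \<open>A new sign pairs \<open>S - v a\<close> with \<open>S + v a\<close>, and odd powers
  cancel. The two moments share one induction because the fourth picks up a multiple of the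
  second.\<close>

lemma rademacher_moments:
  fixes v :: "nat \<Rightarrow> real"
  assumes "finite F"
  defines "S \<equiv> (\<lambda>F T. \<Sum>i\<in>F. sign_of T i * v i)"
  shows "(\<Sum>T\<in>Pow F. (S F T)\<^sup>2) = 2 ^ card F * (\<Sum>i\<in>F. (v i)\<^sup>2) \<and>
    (\<Sum>T\<in>Pow F. (S F T) ^ 4) \<le> 3 * 2 ^ card F * (\<Sum>i\<in>F. (v i)\<^sup>2)\<^sup>2"
  using assms(1)
proof (induction F rule: finite_induct)
  case empty
  then show ?case by (simp add: S_def)
next
  case (insert a F)
  define \<sigma> where "\<sigma> = (\<Sum>i\<in>F. (v i)\<^sup>2)"
  have \<sigma>': "(\<Sum>i\<in>insert a F. (v i)\<^sup>2) = \<sigma> + (v a)\<^sup>2" using insert by (simp add: \<sigma>_def)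
  have 1: "S (insert a F) T = S F T - v a" if "T \<in> Pow F" for T
    using that insert by (auto simp: S_def sign_of_def)
  have 2: "S (insert a F) (insert a T) = S F T + v a" if "T \<in> Pow F" for T
  proof -
    have "(\<Sum>i\<in>F. sign_of (insert a T) i * v i) = S F T"
      unfolding S_def using insert by (intro sum.cong) (auto simp: sign_of_def)
    then show ?thesis using insert by (simp add: S_def sign_of_def)
  qed
  have "(\<Sum>T\<in>Pow (insert a F). (S (insert a F) T)\<^sup>2) = (\<Sum>T\<in>Pow F. 2 * (S F T)\<^sup>2 + 2 * (v a)\<^sup>2)"
    unfolding sum_Pow_insert[OF insert(1,2)]
    by (intro sum.cong refl) (simp add: 1 2 power2_eq_square algebra_simps)
  also have "\<dots> = 2 * (\<Sum>T\<in>Pow F. (S F T)\<^sup>2) + 2 ^ card F * (2 * (v a)\<^sup>2)"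
    using insert(1) by (simp add: sum.distrib sum_distrib_left card_Pow)
  also have "\<dots> = 2 ^ card (insert a F) * (\<sigma> + (v a)\<^sup>2)"
    using insert by (simp add: \<sigma>_def algebra_simps)
  finally have second: "(\<Sum>T\<in>Pow (insert a F). (S (insert a F) T)\<^sup>2) = 2 ^ card (insert a F) * (\<sigma> + (v a)\<^sup>2)" .
  have "(\<Sum>T\<in>Pow (insert a F). (S (insert a F) T) ^ 4)
      = (\<Sum>T\<in>Pow F. 2 * (S F T) ^ 4 + 12 * (v a)\<^sup>2 * (S F T)\<^sup>2 + 2 * (v a) ^ 4)"
    unfolding sum_Pow_insert[OF insert(1,2)]
    by (intro sum.cong refl) (simp add: 1 2 power2_eq_square power4_eq_xxxx algebra_simps)
  also have "\<dots> = 2 * (\<Sum>T\<in>Pow F. (S F T) ^ 4) + 12 * (v a)\<^sup>2 * (\<Sum>T\<in>Pow F. (S F T)\<^sup>2)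
      + 2 ^ card F * (2 * (v a) ^ 4)"
    using insert(1) by (simp add: sum.distrib sum_distrib_left card_Pow)
  \<comment> \<open>Raising the last coefficient from 2 to 6 completes the square of \<sigma> + (v
    a)^2.\<close>
  also have "\<dots> \<le> 2 * (3 * 2 ^ card F * \<sigma>\<^sup>2) + 12 * (v a)\<^sup>2 * (2 ^ card F * \<sigma>)
      + 2 ^ card F * (6 * (v a) ^ 4)"
    using insert.IH by (intro add_mono mult_left_mono) (auto simp: \<sigma>_def)
  also have "\<dots> = 3 * 2 ^ card (insert a F) * (\<sigma> + (v a)\<^sup>2)\<^sup>2"
    using insert by (simp add: power2_eq_square power4_eq_xxxx algebra_simps)
  finally show ?case using second \<sigma>' by simp
qed

text \<open>The indicator of |z| >= 1/2 is bounded below by the quartic 4/7 (z^2 - z^4/8 - 1/4).\<close>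
lemma rademacher_anticoncentration:
  fixes v :: "nat \<Rightarrow> real"
  assumes "finite F" "(\<Sum>i\<in>F. (v i)\<^sup>2) = 1"
  shows "3 / 14 * 2 ^ card F \<le> (\<Sum>T\<in>Pow F. if 1 / 2 \<le> \<bar>\<Sum>i\<in>F. sign_of T i * v i\<bar> then 1 else (0::real))"
proof -
  define S where "S = (\<lambda>T. \<Sum>i\<in>F. sign_of T i * v i)"
  have M: "(\<Sum>T\<in>Pow F. (S T)\<^sup>2) = 2 ^ card F" "(\<Sum>T\<in>Pow F. (S T) ^ 4) \<le> 3 * 2 ^ card F"
    using rademacher_moments[OF assms(1), of v] assms(2) by (auto simp: S_def)
  \<comment> \<open>The moments give 1 - 3/8 - 1/4 = 3/8. Dividing by 7/4, the maximum of the
    quartic z^2 - z^4/8 - 1/4 (at z^2 = 4), leaves 3/14.\<close>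
  have "3 / 8 * 2 ^ card F \<le> (\<Sum>T\<in>Pow F. (S T)\<^sup>2) - (\<Sum>T\<in>Pow F. (S T) ^ 4) / 8 - 2 ^ card F / 4"
    using M by simp
  also have "\<dots> = (\<Sum>T\<in>Pow F. (S T)\<^sup>2 - (S T) ^ 4 / 8 - 1 / 4)"
    using assms(1) by (simp add: sum_subtractf card_Pow flip: sum_divide_distrib)
  also have "\<dots> \<le> (\<Sum>T\<in>Pow F. 7 / 4 * (if 1 / 2 \<le> \<bar>S T\<bar> then 1 else 0))"
  proof (intro sum_mono)
    fix T
    show "(S T)\<^sup>2 - (S T) ^ 4 / 8 - 1 / 4 \<le> 7 / 4 * (if 1 / 2 \<le> \<bar>S T\<bar> then 1 else 0)"
    proof (cases "1 / 2 \<le> \<bar>S T\<bar>")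
      case True
      have "0 \<le> ((S T)\<^sup>2 - 4)\<^sup>2" by simp
      also have "((S T)\<^sup>2 - 4)\<^sup>2 = (S T) ^ 4 - 8 * (S T)\<^sup>2 + 16"
        by (simp add: power2_eq_square power4_eq_xxxx algebra_simps)
      finally show ?thesis using True by simp
    next
      case False
      then have "\<bar>S T\<bar>\<^sup>2 \<le> (1 / 2)\<^sup>2" by (intro power_mono) auto
      then have "(S T)\<^sup>2 \<le> 1 / 4" by (simp add: power2_eq_square)
      moreover have "0 \<le> (S T) ^ 4" by simp
      ultimately have "(S T)\<^sup>2 - (S T) ^ 4 / 8 - 1 / 4 \<le> 0" by linarith
      then show ?thesis using False by simp
    qed
  qed
  also have "\<dots> = 7 / 4 * (\<Sum>T\<in>Pow F. if 1 / 2 \<le> \<bar>S T\<bar> then 1 else 0)"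
    by (simp only: sum_distrib_left)
  finally show ?thesis by (simp add: S_def)
qed

section \<open>Parallel sets of a convex body and the mass of their shells\<close>

lemma distn_eq_L2_set: "distn n x y = L2_set (\<lambda>i. x i - y i) {..<n}"
  by (simp add: distn_def L2_set_def)

text \<open>Compact sets are closed in the full type \<open>nat => real\<close>, and the inclusion
  of \<open>Rn n\<close> is Borel because coordinates from \<open>n\<close> on are the constant
  \<open>undefined\<close>.\<close>

lemma compact_in_sets_lebn:
  assumes "compact A" "A \<subseteq> Rn n"
  shows "A \<in> sets (lebn n)"
proof -
  have "(\<lambda>x. x) \<in> borel_measurable (lebn n)"
  proof (rule measurable_coordinatewise_then_product)
    fix i
    show "(\<lambda>x. x i) \<in> borel_measurable (lebn n)"
    proof (cases "i < n")
      case False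
      then have "(\<lambda>x. x i) \<in> borel_measurable (lebn n) \<longleftrightarrow> (\<lambda>_. undefined :: real) \<in> borel_measurable (lebn n)"
        by (intro measurable_cong) (auto simp: Rn_def PiE_def extensional_def)
      then show ?thesis by simp
    qed measurable
  qed
  then have "(\<lambda>x. x) -` A \<inter> space (lebn n) \<in> sets (lebn n)"
    using assms(1) by (intro measurable_sets[OF _ borel_closed]) (auto intro: compact_imp_closed)
  moreover have "(\<lambda>x. x) -` A \<inter> space (lebn n) = A" using assms(2) by auto
  ultimately show ?thesis by simp
qed

lemma convex_n_enlarge:
  assumes "convex_n n A"
  shows "convex_n n (enlarge n A e)"
  unfolding convex_n_def
proof (intro ballI)
  fix x y t assume "x \<in> enlarge n A e" "y \<in> enlarge n A e" and t: "t \<in> {0..1::real}"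
  then obtain a b where ab: "a \<in> A" "b \<in> A" "distn n x a \<le> e" "distn n y b \<le> e"
    by (auto simp: enlarge_def)
  have "combn n t a b \<in> A" using assms ab t by (auto simp: convex_n_def)
  moreover have "distn n (combn n t x y) (combn n t a b) \<le> e"
  proof -
    have "distn n (combn n t x y) (combn n t a b)
        = L2_set (\<lambda>i. t * (x i - a i) + (1 - t) * (y i - b i)) {..<n}"
      unfolding distn_eq_L2_set by (intro L2_set_cong) (auto simp: combn_def algebra_simps)
    also have "\<dots> \<le> L2_set (\<lambda>i. t * (x i - a i)) {..<n} + L2_set (\<lambda>i. (1 - t) * (y i - b i)) {..<n}"
      by (rule L2_set_triangle_ineq)
    also have "\<dots> = t * distn n x a + (1 - t) * distn n y b"
      using t by (simp add: distn_eq_L2_set L2_set_right_distrib)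
    also have "\<dots> \<le> e" using ab t by (intro convex_bound_le) auto
    finally show ?thesis .
  qed
  ultimately show "combn n t x y \<in> enlarge n A e" by (auto simp: enlarge_def)
qed

text \<open>\<open>v\<close> points from the nearest point \<open>a\<close> of \<open>A\<close> to
  \<open>x\<close>. \<open>A\<close> lies in the half-space v . (y - a) <= 0 and the enlargement
  adds at most \<open>e\<close>; strictness comes from \<open>x\<close> lying at height
  \<open>r > 0\<close> above \<open>a\<close>. So a displacement gaining \<open>e\<close> along
  \<open>v\<close> leaves the enlargement.\<close>

lemma supporting_normal:
  assumes A: "compact A" "A \<noteq> {}" "A \<subseteq> Rn n" "convex_n n A" and x: "x \<in> Rn n" "x \<notin> A"
  shows "\<exists>v. (\<Sum>i<n. (v i)\<^sup>2) = 1 \<and> (\<forall>e. \<forall>y\<in>enlarge n A e. (\<Sum>i<n. v i * (y i - x i)) < e)"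
proof -
  have "continuous_on A (\<lambda>y. \<Sum>i<n. (y i - x i)\<^sup>2)" by (intro continuous_intros)
  then obtain a where a: "a \<in> A" and min: "\<And>b. b \<in> A \<Longrightarrow> (\<Sum>i<n. (a i - x i)\<^sup>2) \<le> (\<Sum>i<n. (b i - x i)\<^sup>2)"
    using continuous_attains_inf[OF A(1,2)] by blast
  define r where "r = distn n x a"
  have "r \<noteq> 0"
  proof
    assume "r = 0"
    then have "\<forall>i<n. x i = a i" by (simp add: r_def distn_eq_L2_set L2_set_eq_0_iff)
    then have "x = a" using x(1) a A(3) by (intro extensionalityI[of _ "{..<n}"]) (auto simp: Rn_def PiE_def)
    then show False using a x by simp
  qed
  moreover have "0 \<le> r" by (simp add: r_def distn_eq_L2_set)
  ultimately have r: "0 < r" by simp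
  have r2: "(\<Sum>i<n. (x i - a i)\<^sup>2) = r\<^sup>2"
    by (simp add: r_def distn_def sum_nonneg)
  define v where "v = (\<lambda>i. (x i - a i) / r)"
  have v1: "(\<Sum>i<n. (v i)\<^sup>2) = 1"
    using r r2 by (simp add: v_def power_divide flip: sum_divide_distrib)
  have vx: "(\<Sum>i<n. v i * (x i - a i)) = r"
    using r r2 by (simp add: v_def power2_eq_square flip: sum_divide_distrib)
  have "(\<Sum>i<n. v i * (y i - x i)) < e" if y: "y \<in> enlarge n A e" for y e
  proof -
    obtain b where b: "b \<in> A" "distn n y b \<le> e" using y by (auto simp: enlarge_def)
    have "0 \<le> (\<Sum>i<n. (a i - x i) * (b i - a i))"
    proof (rule minimizer_variational_inequality)
      fix t :: real assume "0 < t" "t \<le> 1"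
      then have "combn n t b a \<in> A" using A(4) a b by (auto simp: convex_n_def)
      from min[OF this] show "(\<Sum>i<n. (a i - x i)\<^sup>2) \<le> (\<Sum>i<n. (t * b i + (1 - t) * a i - x i)\<^sup>2)"
        by (simp add: combn_def)
    qed
    then have "0 \<le> (\<Sum>i<n. (a i - x i) * (b i - a i)) / r" using r by simp
    also have "\<dots> = - (\<Sum>i<n. v i * (b i - a i))"
      unfolding sum_divide_distrib sum_negf[symmetric]
      using r by (intro sum.cong refl) (simp add: v_def field_simps)
    finally have ba: "(\<Sum>i<n. v i * (b i - a i)) \<le> 0" by simp
    have "(\<Sum>i<n. v i * (y i - b i)) \<le> (\<Sum>i<n. \<bar>v i\<bar> * \<bar>y i - b i\<bar>)"
      by (intro sum_mono) (simp flip: abs_mult)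
    also have "\<dots> \<le> L2_set v {..<n} * distn n y b"
      unfolding distn_eq_L2_set by (rule L2_set_mult_ineq)
    also have "\<dots> \<le> e" using b by (simp add: L2_set_def v1)
    finally have yb: "(\<Sum>i<n. v i * (y i - b i)) \<le> e" .
    have "(\<Sum>i<n. v i * (y i - x i))
        = (\<Sum>i<n. v i * (y i - b i)) + (\<Sum>i<n. v i * (b i - a i)) - (\<Sum>i<n. v i * (x i - a i))"
      by (simp add: algebra_simps flip: sum.distrib sum_subtractf)
    then show ?thesis using ba yb vx r by simp
  qed
  then show ?thesis using v1 by blast
qed

text \<open>Summing layers over all sign vectors counts each point of the shell in a fixed
  proportion. The constant 224/3 is the product of 14/3 from anticoncentration, 2 for both
  orientations, 4 from a layer and 2 from the step length.\<close>

lemma mass_of_shell: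
  assumes n: "n \<ge> 1" and f: "isotropic_logconcave_density n f"
    and A: "convex_body n A" and e: "e > 0"
  shows "measure (density (lebn n) (\<lambda>x. ennreal (f x))) (enlarge n A e - A)
    \<le> 224 / 3 * exp 4 * real n * sqrt (real n) * e"
\<comment> \<open>\<open>measure\<close> is 0 outside the sigma-algebra, which settles the
  non-measurable case; otherwise the enlargement is measurable as the union of its shell with the
  compact \<open>A\<close>.\<close>
proof (cases "enlarge n A e - A \<in> sets (lebn n)")
  case False
  then show ?thesis using e by (simp add: measure_notin_sets)
next
  case shell: True
  note F = isotropic_logconcave_densityD[OF f]
  note [measurable] = F(1) shell
  have A': "compact A" "A \<subseteq> Rn n" "convex_n n A" "A \<noteq> {}" using A by (auto simp: convex_body_def)
  let ?E = "enlarge n A e"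
  have AE: "A \<subseteq> ?E" using A'(2) e by (force simp: enlarge_def distn_def)
  have "(?E - A) \<union> A \<in> sets (lebn n)" using shell compact_in_sets_lebn[OF A'(1,2)] by (rule sets.Un)
  then have E: "?E \<in> sets (lebn n)" using AE by (simp add: Un_absorb2)
  note conv = convex_n_enlarge[OF A'(3), of e]
  define \<delta> where "\<delta> = 2 * sqrt (real n) * e"
  have \<delta>: "\<delta> > 0" using n e by (simp add: \<delta>_def)
  define D where "D = (\<lambda>\<theta>. {x \<in> ?E. aff n 1 (\<lambda>i. \<delta> * \<theta> i) x \<notin> ?E})"
  define \<theta> where "\<theta> = (\<lambda>s T i. s * sign_of T i / sqrt (real n))"
  have \<theta>1: "(\<Sum>i<n. (\<theta> s T i)\<^sup>2) = 1" if "\<bar>s\<bar> = 1" for s T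
  proof -
    have "s\<^sup>2 = 1" using that by (metis power2_abs one_power2)
    then have "(\<Sum>i<n. (\<theta> s T i)\<^sup>2) = (\<Sum>i<n. 1 / real n)"
      by (intro sum.cong) (auto simp: \<theta>_def power_divide power_mult_distrib sign_of_def)
    then show ?thesis using n by simp
  qed
  let ?B = "4 * exp 4 * real n * \<delta>"
  have layer: "D (\<theta> s T) \<in> sets (lebn n)"
      "(\<integral>\<^sup>+x. ennreal (f x) * indicator (D (\<theta> s T)) x \<partial>lebn n) \<le> ennreal ?B" if "\<bar>s\<bar> = 1" for s T
    unfolding D_def by (rule mass_of_directional_layer[OF n f \<theta>1[OF that] \<delta> E conv])+
  \<comment> \<open>The normal depends on \<open>x\<close>, but the lower bound on the number of
    sign vectors that work does not, which allows integration over the shell.\<close>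
  have pointwise: "ennreal (3 / 14 * 2 ^ n) * indicator (?E - A) x
      \<le> (\<Sum>T\<in>Pow {..<n}. indicator (D (\<theta> 1 T)) x + indicator (D (\<theta> (- 1) T)) x)" for x
  proof (cases "x \<in> ?E - A")
    case True
    then have x: "x \<in> Rn n" "x \<notin> A" by (auto simp: enlarge_def)
    obtain v where v: "(\<Sum>i<n. (v i)\<^sup>2) = 1" and far: "\<And>y. y \<in> ?E \<Longrightarrow> (\<Sum>i<n. v i * (y i - x i)) < e"
      using supporting_normal[OF A'(1,4,2,3) x] by blast
    have exits: "x \<in> D (\<theta> s T)" if "1 / 2 \<le> s * (\<Sum>i<n. sign_of T i * v i)" for s T
    proof -
      have "(\<Sum>i<n. v i * (aff n 1 (\<lambda>i. \<delta> * \<theta> s T i) x i - x i))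
          = (\<Sum>i<n. 2 * e * s * (sign_of T i * v i))"
        using n by (intro sum.cong) (auto simp: aff_def \<theta>_def \<delta>_def)
      also have "\<dots> = 2 * e * (s * (\<Sum>i<n. sign_of T i * v i))"
        by (simp add: sum_distrib_left mult.assoc)
      also have "\<dots> \<ge> 2 * e * (1 / 2)" using that e by (intro mult_left_mono) auto
      finally show ?thesis using far[of "aff n 1 (\<lambda>i. \<delta> * \<theta> s T i) x"] True by (force simp: D_def)
    qed
    have "ennreal (3 / 14 * 2 ^ n)
        \<le> ennreal (\<Sum>T\<in>Pow {..<n}. if 1 / 2 \<le> \<bar>\<Sum>i<n. sign_of T i * v i\<bar> then 1 else 0)"
      using rademacher_anticoncentration[of "{..<n}" v] v by (intro ennreal_leI) simp
    also have "\<dots> = (\<Sum>T\<in>Pow {..<n}. ennreal (if 1 / 2 \<le> \<bar>\<Sum>i<n. sign_of T i * v i\<bar> then 1 else 0))"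
      by (subst sum_ennreal) auto
    also have "\<dots> \<le> (\<Sum>T\<in>Pow {..<n}. indicator (D (\<theta> 1 T)) x + indicator (D (\<theta> (- 1) T)) x)"
    proof (intro sum_mono)
      fix T
      \<comment> \<open>A negative sum is served by the opposite direction, hence the pair of
        layers.\<close>
      show "ennreal (if 1 / 2 \<le> \<bar>\<Sum>i<n. sign_of T i * v i\<bar> then 1 else 0)
          \<le> indicator (D (\<theta> 1 T)) x + indicator (D (\<theta> (- 1) T)) x"
        using exits[of 1 T] exits[of "- 1" T] by (auto simp: indicator_def abs_if)
    qed
    finally show ?thesis using True by simp
  qed simp
  have sum_const: "(\<Sum>T\<in>Pow {..<n}. ennreal b + ennreal b) = ennreal (2 ^ n * (2 * b))" if "0 \<le> b" for b
  proof -
    have "(\<Sum>T\<in>Pow {..<n}. ennreal b + ennreal b) = ennreal (\<Sum>T\<in>Pow {..<n}. b + b)"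
      unfolding ennreal_plus[OF that that, symmetric] using that by (intro sum_ennreal) simp
    then show ?thesis by (simp add: card_Pow)
  qed
  let ?M = "\<integral>\<^sup>+x. ennreal (f x) * indicator (?E - A) x \<partial>lebn n"
  have "ennreal (3 / 14 * 2 ^ n) * ?M
      = (\<integral>\<^sup>+x. ennreal (f x) * (ennreal (3 / 14 * 2 ^ n) * indicator (?E - A) x) \<partial>lebn n)"
    by (subst nn_integral_cmult[symmetric]) (auto simp: mult_ac)
  also have "\<dots> \<le> (\<integral>\<^sup>+x. (\<Sum>T\<in>Pow {..<n}. ennreal (f x) * indicator (D (\<theta> 1 T)) x
      + ennreal (f x) * indicator (D (\<theta> (- 1) T)) x) \<partial>lebn n)"
    using pointwise by (intro nn_integral_mono) (simp add: mult_left_mono flip: distrib_left sum_distrib_left)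
  also have "\<dots> = (\<Sum>T\<in>Pow {..<n}. (\<integral>\<^sup>+x. ennreal (f x) * indicator (D (\<theta> 1 T)) x \<partial>lebn n)
      + (\<integral>\<^sup>+x. ennreal (f x) * indicator (D (\<theta> (- 1) T)) x \<partial>lebn n))"
    using layer(1) by (simp add: nn_integral_sum nn_integral_add)
  also have "\<dots> \<le> (\<Sum>T\<in>Pow {..<n}. ennreal ?B + ennreal ?B)"
    using layer(2) by (intro sum_mono add_mono) auto
  also have "\<dots> = ennreal (2 ^ n * (2 * ?B))"
    using \<delta> by (intro sum_const) simp
  finally have M: "ennreal (3 / 14 * 2 ^ n) * ?M \<le> ennreal (2 ^ n * (2 * ?B))" .
  have "?M = ennreal (14 / (3 * 2 ^ n)) * (ennreal (3 / 14 * 2 ^ n) * ?M)"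
    by (simp flip: mult.assoc ennreal_mult)
  also have "\<dots> \<le> ennreal (14 / (3 * 2 ^ n)) * ennreal (2 ^ n * (2 * ?B))"
    by (rule mult_left_mono[OF M]) simp
  also have "\<dots> = ennreal (28 / 3 * ?B)" using \<delta> by (simp flip: ennreal_mult)
  finally have "?M \<le> ennreal (28 / 3 * ?B)" .
  then have "emeasure (density (lebn n) (\<lambda>x. ennreal (f x))) (?E - A) \<le> ennreal (28 / 3 * ?B)"
    using shell by (simp add: emeasure_density)
  then have "measure (density (lebn n) (\<lambda>x. ennreal (f x))) (?E - A) \<le> 28 / 3 * ?B"
    unfolding measure_def using \<delta> by (intro enn2real_leI) auto
  also have "\<dots> = 224 / 3 * exp 4 * real n * sqrt (real n) * e" by (simp add: \<delta>_def)
  finally show ?thesis .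
qed

theorem theorem1p1:
  shows "\<exists>C>0. \<forall>n\<ge>1. \<forall>f. isotropic_logconcave_density n f \<longrightarrow>
           max_perimeter n (density (lebn n) (\<lambda>x. ennreal (f x))) \<le> ereal (C * real n powr (3/2))"
proof (intro exI[of _ "224 / 3 * exp 4"] conjI allI impI)
  fix n f assume n: "1 \<le> n" and f: "isotropic_logconcave_density n f"
  let ?K = "224 / 3 * exp 4 * real n powr (3/2)"
  have powr: "real n powr (3/2) = real n * sqrt (real n)"
  proof -
    have "real n powr (3/2) = real n powr (1 + 1/2)" by simp
    also have "\<dots> = real n * sqrt (real n)" using n by (subst powr_add) (simp add: powr_half_sqrt)
    finally show ?thesis .
  qed
  have "perimeter n (density (lebn n) (\<lambda>x. ennreal (f x))) A \<le> ereal ?K" if A: "convex_body n A" for A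
  proof -
    have "perimeter n (density (lebn n) (\<lambda>x. ennreal (f x))) A \<le> Liminf (at_right (0::real)) (\<lambda>_. ereal ?K)"
      unfolding perimeter_def
    proof (rule Liminf_mono)
      show "\<forall>\<^sub>F e in at_right 0. ereal (measure (density (lebn n) (\<lambda>x. ennreal (f x))) (enlarge n A e - A) / e) \<le> ereal ?K"
        unfolding eventually_at_right_field
      proof (intro exI[of _ 1] conjI allI impI)
        fix e :: real assume e: "0 < e"
        show "ereal (measure (density (lebn n) (\<lambda>x. ennreal (f x))) (enlarge n A e - A) / e) \<le> ereal ?K"
          using mass_of_shell[OF n f A e] e by (simp add: powr pos_divide_le_eq mult.assoc)
      qed simp
    qed
    then show ?thesis by (simp add: Liminf_const)
  qed
  then show "max_perimeter n (density (lebn n) (\<lambda>x. ennreal (f x))) \<le> ereal ?K"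
    unfolding max_perimeter_def by (intro SUP_least) simp
qed simp

end
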